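(* Let $\mathcal{P}$ be a single machine scheduling problem (of the kind described in the context) in which $w_j=1$ for every job $j$. If $\textsc{Min-Max}~\mathcal{P}$ with $K\ge2$ scenarios is NP-hard and hard to approximate within $\rho>1$, then: (1) for each constant $\alpha\in(0,1)$, $\textsc{Min-VaR}_\alpha~\mathcal{P}$ with $K+1$ scenarios is NP-hard and hard to approximate within $\rho$; (2) for each constant $\alpha\in(0,1)$, $\textsc{Min-CVaR}_\alpha~\mathcal{P}$ with $K+1$ scenarios is NP-hard.
   Context: A single machine scheduling instance: a set $J$ of $n$ jobs, possibly with precedence constraints; a schedule $\pi$ is a permutation of $J$ respecting the precedence constraints, processed without idle time from time 0; $\Pi$ is the set of feasible schedules. Job $j$ has nonnegative processing time $p_j$, due date $d_j$ and weight $w_j$; $C_j(\pi)$ is its completion time, $T_j(\pi)=\max\{0,C_j(\pi)-d_j\}$, $U_j(\pi)=1$ if $C_j(\pi)>d_j$ and $0$ otherwise. The problem $\mathcal{P}$ (Graham notation $1|\beta|\gamma$) has as cost function one of the total flow time $\sum C_j$, total tardiness $\sum T_j$, maximum tardiness $\max_j T_j$, number of late jobs $\sum U_j$ (or their weighted versions). Uncertainty: a scenario set $\mathcal{U}=\{\xi_1,\dots,\xi_K\}$ is part of the input; each scenario $\xi$ specifies processing times $p_j(\xi)$ and due dates $d_j(\xi)$, with probability ${\rm Pr}[\xi]>0$, $\sum_i{\rm Pr}[\xi_i]=1$; $f(\pi,\xi)$ is the cost of $\pi$ under $\xi$; ${\rm F}(\pi)$ is the random variable equal to $f(\pi,\xi_i)$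 with probability ${\rm Pr}[\xi_i]$. $\textsc{Min-Max}~\mathcal{P}$ minimizes $\max_{i}f(\pi,\xi_i)$; $\textsc{Min-VaR}_\alpha~\mathcal{P}$ minimizes $\mathbf{VaR}_\alpha[{\rm F}(\pi)]$ with $\mathbf{VaR}_\alpha[\mathrm{Y}]=\inf\{t:{\rm Pr}[\mathrm{Y}\le t]\ge\alpha\}$; $\textsc{Min-CVaR}_\alpha~\mathcal{P}$ minimizes $\mathbf{CVaR}_\alpha[{\rm F}(\pi)]$ with $\mathbf{CVaR}_\alpha[\mathrm{Y}]=\inf_{\gamma\in\mathbb{R}}\{\gamma+\frac{1}{1-\alpha}\mathbf{E}[(\mathrm{Y}-\gamma)^+]\}$. "Hard to approximate within $\rho$" means no polynomial-time algorithm returns schedules with objective at most $\rho$ times the optimum, unless P=NP. *)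

theory Defs
  imports
    "HOL-Probability.Probability"
    "HOL-Combinatorics.Multiset_Permutations"
    "HOL-Computational_Algebra.Polynomial"
begin

section \<open>Polynomial time, NP, and hardness of optimization problems\<close>

text \<open>
  Complexity is measured on structured programs over finitely many stacks of symbols from a fixed
  finite alphabet. A stack is one half of a Turing tape and the primitive operations are unit-cost,
  local ones, so these programs and multi-tape Turing machines simulate each other with polynomial
  overhead.
\<close>

datatype sym = Digit bool | Sep | Open | Close

type_synonym word = "sym list"
type_synonym state = "nat \<Rightarrow> word"

definition top_of :: "state \<Rightarrow> nat \<Rightarrow> sym option" where
  "top_of s X = (case s X of [] \<Rightarrow> None | a # _ \<Rightarrow> Some a)"

datatype prog =
    Skip
  | Push nat sym
  | Pop nat
  | Query nat
  | Seq prog prog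
  | Branch nat "sym option set" prog prog
  | Loop nat "sym option set" prog

text \<open>
  \<open>exec g c s t s'\<close>: with oracle \<open>g\<close>, program \<open>c\<close> started in \<open>s\<close> halts in \<open>s'\<close> after time \<open>t\<close>.
  A query is charged for the length of the question and of the answer.
\<close>

inductive exec :: "(word \<Rightarrow> word) \<Rightarrow> prog \<Rightarrow> state \<Rightarrow> nat \<Rightarrow> state \<Rightarrow> bool"
  for g :: "word \<Rightarrow> word" where
  Skip: "exec g Skip s 1 s"
| Push: "exec g (Push X a) s 1 (s(X := a # s X))"
| Pop: "exec g (Pop X) s 1 (s(X := tl (s X)))"
| Query: "exec g (Query X) s (1 + length (s X) + length (g (s X))) (s(X := g (s X)))"
| Seq: "exec g c1 s t1 s1 \<Longrightarrow> exec g c2 s1 t2 s2 \<Longrightarrow> exec g (Seq c1 c2) s (t1 + t2) s2"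
| BranchT: "top_of s X \<in> A \<Longrightarrow> exec g c1 s t s' \<Longrightarrow> exec g (Branch X A c1 c2) s (1 + t) s'"
| BranchF: "top_of s X \<notin> A \<Longrightarrow> exec g c2 s t s' \<Longrightarrow> exec g (Branch X A c1 c2) s (1 + t) s'"
| LoopF: "top_of s X \<notin> A \<Longrightarrow> exec g (Loop X A c) s 1 s"
| LoopT: "top_of s X \<in> A \<Longrightarrow> exec g c s t1 s1 \<Longrightarrow> exec g (Loop X A c) s1 t2 s2 \<Longrightarrow>
    exec g (Loop X A c) s (1 + t1 + t2) s2"

primrec query_free :: "prog \<Rightarrow> bool" where
  "query_free Skip = True"
| "query_free (Push X a) = True"
| "query_free (Pop X) = True"
| "query_free (Query X) = False"
| "query_free (Seq c1 c2) = (query_free c1 \<and> query_free c2)"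
| "query_free (Branch X A c1 c2) = (query_free c1 \<and> query_free c2)"
| "query_free (Loop X A c) = query_free c"

definition init :: "word list \<Rightarrow> state" where
  "init xs = (\<lambda>i. if i < length xs then xs ! i else [])"

text \<open>Inputs are placed on the first stacks; the output is read off stack 0.\<close>

definition outputs :: "(word \<Rightarrow> word) \<Rightarrow> prog \<Rightarrow> word list \<Rightarrow> nat \<Rightarrow> word \<Rightarrow> bool" where
  "outputs g c xs b y \<longleftrightarrow> (\<exists>t s. exec g c (init xs) t s \<and> t \<le> b \<and> s 0 = y)"

definition no_oracle :: "word \<Rightarrow> word" where
  "no_oracle = (\<lambda>_. [])"

definition verdict :: "bool \<Rightarrow> word" where
  "verdict b = [Digit b]"

definition class_P :: "word set set" where
  "class_P = {L. \<exists>c (p :: nat poly). query_free c \<and>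
     (\<forall>x. outputs no_oracle c [x] (poly p (length x)) (verdict (x \<in> L)))}"

definition class_NP :: "word set set" where
  "class_NP = {L. \<exists>c (p :: nat poly) (q :: nat poly) V. query_free c \<and>
     (\<forall>x y. outputs no_oracle c [x, y] (poly p (length x + length y)) (verdict (V x y))) \<and>
     (\<forall>x. x \<in> L \<longleftrightarrow> (\<exists>y. length y \<le> poly q (length x) \<and> V x y))}"

record ('i, 's) min_problem =
  instances :: "'i set"
  solutions :: "'i \<Rightarrow> 's set"
  objective :: "'i \<Rightarrow> 's \<Rightarrow> real"
  enc_instance :: "'i \<Rightarrow> word"
  enc_solution :: "'s \<Rightarrow> word"

definition opt_value :: "('i, 's) min_problem \<Rightarrow> 'i \<Rightarrow> real" where
  "opt_value A I = Min (objective A I ` solutions A I)"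

text \<open>The search problems of finding an optimal, resp. a \<open>\<rho>\<close>-approximate, solution, as relations
  between input and output words.\<close>

definition optimal_answer :: "('i, 's) min_problem \<Rightarrow> word \<Rightarrow> word \<Rightarrow> bool" where
  "optimal_answer A x y \<longleftrightarrow> (\<exists>I \<in> instances A. \<exists>S \<in> solutions A I.
     x = enc_instance A I \<and> y = enc_solution A S \<and> objective A I S = opt_value A I)"

definition approx_answer :: "real \<Rightarrow> ('i, 's) min_problem \<Rightarrow> word \<Rightarrow> word \<Rightarrow> bool" where
  "approx_answer \<rho> A x y \<longleftrightarrow> (\<exists>I \<in> instances A. \<exists>S \<in> solutions A I.
     x = enc_instance A I \<and> y = enc_solution A S \<and> objective A I S \<le> \<rho> * opt_value A I)"

definition solves :: "(word \<Rightarrow> word) \<Rightarrow> (word \<Rightarrow> word \<Rightarrow> bool) \<Rightarrow> bool" where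
  "solves g R \<longleftrightarrow> (\<forall>x. (\<exists>y. R x y) \<longrightarrow> R x (g x))"

text \<open>NP-hardness of an optimization (search) problem in the sense of Garey and Johnson: every
  language in NP is polynomial-time Turing reducible to it.\<close>

definition NP_hard :: "('i, 's) min_problem \<Rightarrow> bool" where
  "NP_hard A \<longleftrightarrow> (\<forall>L \<in> class_NP. \<exists>c (p :: nat poly). \<forall>g. solves g (optimal_answer A) \<longrightarrow>
     (\<forall>x. outputs g c [x] (poly p (length x)) (verdict (x \<in> L))))"

definition polytime_solvable :: "(word \<Rightarrow> word \<Rightarrow> bool) \<Rightarrow> bool" where
  "polytime_solvable R \<longleftrightarrow> (\<exists>c (p :: nat poly). query_free c \<and>
     (\<forall>x. (\<exists>y. R x y) \<longrightarrow> (\<exists>y. outputs no_oracle c [x] (poly p (length x)) y \<and> R x y)))"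

definition hard_to_approximate :: "real \<Rightarrow> ('i, 's) min_problem \<Rightarrow> bool" where
  "hard_to_approximate \<rho> A \<longleftrightarrow>
     (class_P \<noteq> class_NP \<longrightarrow> \<not> polytime_solvable (approx_answer \<rho> A))"


section \<open>Single machine scheduling\<close>

datatype criterion = FlowTime | Tardiness | MaxTardiness | LateJobs

text \<open>The jobs are \<open>0, \<dots>, n - 1\<close> and a schedule is the list of jobs in processing order.\<close>

definition completion :: "(nat \<Rightarrow> real) \<Rightarrow> nat list \<Rightarrow> nat \<Rightarrow> real" where
  "completion p \<pi> j = sum_list (map p (takeWhile (\<lambda>i. i \<noteq> j) \<pi>)) + p j"

definition tardiness :: "(nat \<Rightarrow> real) \<Rightarrow> (nat \<Rightarrow> real) \<Rightarrow> nat list \<Rightarrow> nat \<Rightarrow> real" where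
  "tardiness p d \<pi> j = max 0 (completion p \<pi> j - d j)"

definition late :: "(nat \<Rightarrow> real) \<Rightarrow> (nat \<Rightarrow> real) \<Rightarrow> nat list \<Rightarrow> nat \<Rightarrow> real" where
  "late p d \<pi> j = (if completion p \<pi> j > d j then 1 else 0)"

fun cost :: "criterion \<Rightarrow> (nat \<Rightarrow> real) \<Rightarrow> (nat \<Rightarrow> real) \<Rightarrow> (nat \<Rightarrow> real) \<Rightarrow> nat list \<Rightarrow> real" where
  "cost FlowTime w p d \<pi> = (\<Sum>j\<in>set \<pi>. w j * completion p \<pi> j)"
| "cost Tardiness w p d \<pi> = (\<Sum>j\<in>set \<pi>. w j * tardiness p d \<pi> j)"
| "cost MaxTardiness w p d \<pi> = Max ((\<lambda>j. w j * tardiness p d \<pi> j) ` set \<pi>)"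
| "cost LateJobs w p d \<pi> = (\<Sum>j\<in>set \<pi>. w j * late p d \<pi> j)"

text \<open>The job \<open>j\<close> has processing time \<open>fst (\<xi> ! j)\<close> and due date \<open>snd (\<xi> ! j)\<close> under scenario \<open>\<xi>\<close>.\<close>

type_synonym scenario = "(rat \<times> rat) list"

definition ptime :: "scenario \<Rightarrow> nat \<Rightarrow> real" where
  "ptime \<xi> j = real_of_rat (fst (\<xi> ! j))"

definition ddate :: "scenario \<Rightarrow> nat \<Rightarrow> real" where
  "ddate \<xi> j = real_of_rat (snd (\<xi> ! j))"

text \<open>
  The \<open>\<beta>\<close> field of a problem \<open>1|\<beta>|\<gamma>\<close>: \<open>prec_class n R\<close> tells which precedence relations on \<open>n\<close> jobs
  are admitted (only the empty one, chains, trees, arbitrary ones, \<dots>), and \<open>unit_times\<close> whether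
  \<open>p\<^sub>j = 1\<close> is imposed.
\<close>

record problem =
  prec_class :: "nat \<Rightarrow> (nat \<times> nat) set \<Rightarrow> bool"
  unit_times :: bool
  criterion_of :: criterion

record uncertain_instance =
  njobs :: nat
  precs :: "(nat \<times> nat) list"
  scenarios :: "scenario list"

definition valid_scenario :: "problem \<Rightarrow> nat \<Rightarrow> scenario \<Rightarrow> bool" where
  "valid_scenario P n \<xi> \<longleftrightarrow> length \<xi> = n \<and>
     (\<forall>(p, d) \<in> set \<xi>. 0 \<le> p \<and> 0 \<le> d \<and> (unit_times P \<longrightarrow> p = 1))"

definition uncertain_instances :: "problem \<Rightarrow> nat \<Rightarrow> uncertain_instance set" where
  "uncertain_instances P K = {I. njobs I > 0 \<and>
     set (precs I) \<subseteq> {..<njobs I} \<times> {..<njobs I} \<and> acyclic (set (precs I)) \<and>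
     prec_class P (njobs I) (set (precs I)) \<and>
     length (scenarios I) = K \<and> (\<forall>\<xi> \<in> set (scenarios I). valid_scenario P (njobs I) \<xi>)}"

definition schedules :: "uncertain_instance \<Rightarrow> nat list set" where
  "schedules I = {\<pi> \<in> permutations_of_set {..<njobs I}.
     \<forall>a < njobs I. \<forall>b < njobs I. (\<pi> ! a, \<pi> ! b) \<in> set (precs I) \<longrightarrow> a < b}"

definition unit_weight_cost :: "problem \<Rightarrow> nat list \<Rightarrow> scenario \<Rightarrow> real" where
  "unit_weight_cost P \<pi> \<xi> = cost (criterion_of P) (\<lambda>_. 1) (ptime \<xi>) (ddate \<xi>) \<pi>"


section \<open>Encodings\<close>

fun bits :: "nat \<Rightarrow> bool list" where
  "bits n = (if n = 0 then [] else odd n # bits (n div 2))"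

declare bits.simps [simp del]

definition enc_nat :: "nat \<Rightarrow> word" where
  "enc_nat n = map Digit (bits n) @ [Sep]"

text \<open>Only nonnegative rationals occur, so no sign is recorded.\<close>

definition enc_rat :: "rat \<Rightarrow> word" where
  "enc_rat r = enc_nat (nat (fst (quotient_of r))) @ enc_nat (nat (snd (quotient_of r)))"

definition enc_list :: "('a \<Rightarrow> word) \<Rightarrow> 'a list \<Rightarrow> word" where
  "enc_list e xs = Open # concat (map e xs) @ [Close]"

text \<open>The number of jobs is written in unary; every scenario lists all jobs anyway.\<close>

definition enc_uncertain :: "uncertain_instance \<Rightarrow> word" where
  "enc_uncertain I = replicate (njobs I) (Digit True) @ [Sep] @
     enc_list (\<lambda>(i, j). enc_nat i @ enc_nat j) (precs I) @
     enc_list (enc_list (\<lambda>(p, d). enc_rat p @ enc_rat d)) (scenarios I)"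


section \<open>The min-max, value at risk and conditional value at risk problems\<close>

definition Min_Max :: "problem \<Rightarrow> nat \<Rightarrow> (uncertain_instance, nat list) min_problem" where
  "Min_Max P K = \<lparr>
     instances = uncertain_instances P K,
     solutions = schedules,
     objective = (\<lambda>I \<pi>. Max (unit_weight_cost P \<pi> ` set (scenarios I))),
     enc_instance = enc_uncertain,
     enc_solution = enc_list enc_nat\<rparr>"

definition VaR :: "real \<Rightarrow> real pmf \<Rightarrow> real" where
  "VaR \<alpha> Y = Inf {t. measure_pmf.prob Y {..t} \<ge> \<alpha>}"

definition CVaR :: "real \<Rightarrow> real pmf \<Rightarrow> real" where
  "CVaR \<alpha> Y = (INF \<gamma>. \<gamma> + 1 / (1 - \<alpha>) * measure_pmf.expectation Y (\<lambda>y. max 0 (y - \<gamma>)))"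

text \<open>Instances with scenario probabilities, the \<open>i\<close>-th probability belonging to the \<open>i\<close>-th
  scenario.\<close>

type_synonym stochastic_instance = "uncertain_instance \<times> rat list"

definition stochastic_instances :: "problem \<Rightarrow> nat \<Rightarrow> stochastic_instance set" where
  "stochastic_instances P K = {(I, q). I \<in> uncertain_instances P K \<and>
     length q = K \<and> (\<forall>r \<in> set q. r > 0) \<and> sum_list q = 1}"

definition random_cost :: "problem \<Rightarrow> stochastic_instance \<Rightarrow> nat list \<Rightarrow> real pmf" where
  "random_cost P J \<pi> = pmf_of_list
     (zip (map (unit_weight_cost P \<pi>) (scenarios (fst J))) (map real_of_rat (snd J)))"

definition enc_stochastic :: "stochastic_instance \<Rightarrow> word" where
  "enc_stochastic J = enc_list enc_rat (snd J) @ enc_uncertain (fst J)"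

definition Min_Risk ::
  "(real pmf \<Rightarrow> real) \<Rightarrow> problem \<Rightarrow> nat \<Rightarrow> (stochastic_instance, nat list) min_problem" where
  "Min_Risk \<phi> P K = \<lparr>
     instances = stochastic_instances P K,
     solutions = schedules \<circ> fst,
     objective = (\<lambda>J \<pi>. \<phi> (random_cost P J \<pi>)),
     enc_instance = enc_stochastic,
     enc_solution = enc_list enc_nat\<rparr>"

definition Min_VaR :: "real \<Rightarrow> problem \<Rightarrow> nat \<Rightarrow> (stochastic_instance, nat list) min_problem" where
  "Min_VaR \<alpha> = Min_Risk (VaR \<alpha>)"

definition Min_CVaR :: "real \<Rightarrow> problem \<Rightarrow> nat \<Rightarrow> (stochastic_instance, nat list) min_problem" where
  "Min_CVaR \<alpha> = Min_Risk (CVaR \<alpha>)"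

end

theory Submission imports Defs begin

text \<open>
  Fix a rational \<open>a\<close> with \<open>a - a / K < \<alpha> < a < 1\<close>. Given a min-max instance, add one scenario of
  probability \<open>1 - a\<close> in which all due dates are \<open>0\<close> and all processing times equal a common upper
  bound of the given ones, and give each old scenario the probability \<open>a / K\<close>. The cost \<open>M\<close> of the new
  scenario dominates the old costs, and it does not depend on the schedule since all jobs look alike.
  Hence the maximum \<open>m\<close> of the old costs is an \<open>\<alpha>\<close>-quantile that only the new scenario exceeds: the
  value at risk equals \<open>m\<close>, and the conditional value at risk equals
  \<open>((1 - a) M + (a - \<alpha>) m) / (1 - \<alpha>)\<close>, so that optimal schedules, and for the value at risk also
  approximation ratios, are preserved.

  On words, the reduction prepends a constant word and inserts the new scenario before the final
  bracket. As processing time it uses \<open>1\<close> if unit times are imposed, and otherwise the power of two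
  whose exponent is the length of the input.
\<close>

section \<open>Running stack programs within a time bound\<close>

definition runs :: "(word \<Rightarrow> word) \<Rightarrow> prog \<Rightarrow> state \<Rightarrow> nat \<Rightarrow> state \<Rightarrow> bool" where
  "runs g c s b s' \<longleftrightarrow> (\<exists>t\<le>b. exec g c s t s')"

lemma outputs_iff_runs: "outputs g c xs b y \<longleftrightarrow> (\<exists>s. runs g c (init xs) b s \<and> s 0 = y)"
  by (auto simp: outputs_def runs_def)

lemma runs_mono: "runs g c s b s' \<Longrightarrow> b \<le> b' \<Longrightarrow> runs g c s b' s'"
  unfolding runs_def using order_trans by blast

lemma runs_Skip: "runs g Skip s 1 s"
  unfolding runs_def using exec.Skip by blast

lemma runs_Push: "runs g (Push X a) s 1 (s(X := a # s X))"
  unfolding runs_def using exec.Push by blast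

lemma runs_Pop: "runs g (Pop X) s 1 (s(X := tl (s X)))"
  unfolding runs_def using exec.Pop by blast

lemma runs_Query: "runs g (Query X) s (1 + length (s X) + length (g (s X))) (s(X := g (s X)))"
  unfolding runs_def using exec.Query by blast

lemma runs_Seq:
  "runs g c1 s b1 s1 \<Longrightarrow> runs g c2 s1 b2 s2 \<Longrightarrow> runs g (Seq c1 c2) s (b1 + b2) s2"
  unfolding runs_def by (meson add_mono exec.Seq)

lemma runs_BranchT:
  "top_of s X \<in> A \<Longrightarrow> runs g c1 s b s' \<Longrightarrow> runs g (Branch X A c1 c2) s (1 + b) s'"
  unfolding runs_def by (meson add_left_mono exec.BranchT)

lemma runs_BranchF:
  "top_of s X \<notin> A \<Longrightarrow> runs g c2 s b s' \<Longrightarrow> runs g (Branch X A c1 c2) s (1 + b) s'"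
  unfolding runs_def by (meson add_left_mono exec.BranchF)

lemma runs_LoopF: "top_of s X \<notin> A \<Longrightarrow> runs g (Loop X A c) s 1 s"
  unfolding runs_def using exec.LoopF by blast

lemma runs_LoopT:
  assumes "top_of s X \<in> A" "runs g c s b1 s1" "runs g (Loop X A c) s1 b2 s2"
  shows "runs g (Loop X A c) s (1 + b1 + b2) s2"
proof -
  obtain t1 t2 where "t1 \<le> b1" "exec g c s t1 s1" "t2 \<le> b2" "exec g (Loop X A c) s1 t2 s2"
    using assms(2,3) by (auto simp: runs_def)
  then have "exec g (Loop X A c) s (1 + t1 + t2) s2" "1 + t1 + t2 \<le> 1 + b1 + b2"
    using exec.LoopT[OF assms(1)] by auto
  then show ?thesis unfolding runs_def by blast
qed

lemma top_of_Nil: "s X = [] \<Longrightarrow> top_of s X = None"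
  by (simp add: top_of_def)

lemma top_of_Cons: "s X = a # w \<Longrightarrow> top_of s X = Some a"
  by (simp add: top_of_def)

text \<open>In \<open>\<sigma> u v\<close> the loop has consumed \<open>rev u\<close> from stack \<open>X\<close>, and \<open>v\<close> is left.\<close>

lemma runs_Loop_takeWhile:
  assumes stack: "\<And>u v. \<sigma> u v X = v"
    and step: "\<And>u a v. a \<in> A \<Longrightarrow> runs g c (\<sigma> u (a # v)) b (\<sigma> (a # u) v)"
  shows "runs g (Loop X (Some ` A) c) (\<sigma> u w) (length (takeWhile (\<lambda>a. a \<in> A) w) * (b + 1) + 1)
    (\<sigma> (rev (takeWhile (\<lambda>a. a \<in> A) w) @ u) (dropWhile (\<lambda>a. a \<in> A) w))"
proof (induction w arbitrary: u)
  case Nil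
  then show ?case
    using runs_LoopF[of "\<sigma> u []" X] by (simp add: top_of_Nil stack image_iff)
next
  case (Cons a w)
  show ?case
  proof (cases "a \<in> A")
    case True
    then have "top_of (\<sigma> u (a # w)) X \<in> Some ` A"
      by (simp add: top_of_Cons stack)
    from runs_LoopT[OF this step[OF True] Cons.IH] True show ?thesis
      by (simp add: algebra_simps)
  next
    case False
    then show ?thesis
      using runs_LoopF[of "\<sigma> u (a # w)" X] by (simp add: top_of_Cons stack image_iff)
  qed
qed

lemma runs_Loop_all:
  assumes "\<And>u v. \<sigma> u v X = v" and "\<And>u a v. runs g c (\<sigma> u (a # v)) b (\<sigma> (a # u) v)"
  shows "runs g (Loop X (range Some) c) (\<sigma> [] w) (length w * (b + 1) + 1) (\<sigma> (rev w) [])"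
proof -
  have "takeWhile (\<lambda>a. a \<in> UNIV) w = w" "dropWhile (\<lambda>a. a \<in> UNIV) w = []"
    by simp_all
  then show ?thesis
    using runs_Loop_takeWhile[of \<sigma> X UNIV g c b "[]" w] assms by (simp only: append_Nil2)
qed

section \<open>Moving words between stacks\<close>

primrec push_word :: "nat \<Rightarrow> word \<Rightarrow> prog" where
  "push_word X [] = Skip"
| "push_word X (a # w) = Seq (push_word X w) (Push X a)"

lemma runs_push_word: "runs g (push_word X w) s (length w + 1) (s(X := w @ s X))"
proof (induction w)
  case Nil
  then show ?case using runs_Skip[of g s] by simp
next
  case (Cons a w)
  from runs_Seq[OF this runs_Push[of g X a]] show ?case
    by (simp add: fun_upd_same del: fun_upd_apply)
qed

lemma query_free_push_word: "query_free (push_word X w)"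
  by (induction w) auto

primrec move_top_among :: "sym list \<Rightarrow> nat \<Rightarrow> nat \<Rightarrow> prog" where
  "move_top_among [] X Y = Skip"
| "move_top_among (a # as) X Y =
     Branch X {Some a} (Seq (Pop X) (Push Y a)) (move_top_among as X Y)"

lemma runs_move_top_among:
  assumes "a \<in> set as" "s X = a # w" "X \<noteq> Y"
  shows "runs g (move_top_among as X Y) s (length as + 2) (s(X := w, Y := a # s Y))"
  using assms(1)
proof (induction as)
  case (Cons b as)
  show ?case
  proof (cases "a = b")
    case True
    have "runs g (Seq (Pop X) (Push Y a)) s (1 + 1) (s(X := w, Y := a # s Y))"
      using runs_Seq[OF runs_Pop[of g X s] runs_Push[of g Y a]] assms(2,3) by simp
    then have "runs g (move_top_among (b # as) X Y) s (1 + (1 + 1)) (s(X := w, Y := a # s Y))"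
      unfolding move_top_among.simps
      using True assms(2) by (intro runs_BranchT) (simp_all add: top_of_Cons)
    then show ?thesis by (rule runs_mono) simp
  next
    case False
    then have "runs g (move_top_among (b # as) X Y) s (1 + (length as + 2)) (s(X := w, Y := a # s Y))"
      unfolding move_top_among.simps
      using Cons assms(2) by (intro runs_BranchF) (auto simp: top_of_Cons simp del: fun_upd_apply)
    then show ?thesis by (simp del: fun_upd_apply)
  qed
qed simp

definition move_top :: "nat \<Rightarrow> nat \<Rightarrow> prog" where
  "move_top = move_top_among [Digit True, Digit False, Sep, Open, Close]"

lemma runs_move_top:
  assumes "s X = a # w" "X \<noteq> Y"
  shows "runs g (move_top X Y) s 7 (s(X := w, Y := a # s Y))"
proof -
  have "a \<in> set [Digit True, Digit False, Sep, Open, Close]"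
    by (cases a) auto
  from runs_move_top_among[where s = s and g = g, OF this assms] show ?thesis
    unfolding move_top_def by (rule runs_mono) simp
qed

lemma query_free_move_top: "query_free (move_top X Y)"
  by (simp add: move_top_def)

definition pour :: "nat \<Rightarrow> nat \<Rightarrow> prog" where
  "pour X Y = Loop X (range Some) (move_top X Y)"

lemma runs_pour:
  assumes "X \<noteq> Y"
  shows "runs g (pour X Y) s (8 * length (s X) + 1) (s(X := [], Y := rev (s X) @ s Y))"
proof -
  define \<sigma> where "\<sigma> u v = s(X := v, Y := u @ s Y)" for u v
  have "runs g (move_top X Y) (\<sigma> u (a # v)) 7 (\<sigma> (a # u) v)" for u a v
    using runs_move_top[of "\<sigma> u (a # v)" X a v Y] assms by (simp add: \<sigma>_def)
  from runs_Loop_all[of \<sigma> X, OF _ this, of "s X"] assms show ?thesis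
    by (simp add: pour_def \<sigma>_def mult.commute)
qed

definition transfer :: "nat \<Rightarrow> nat \<Rightarrow> nat \<Rightarrow> prog" where
  "transfer X Y Z = Seq (pour X Y) (pour Y Z)"

lemma runs_transfer:
  assumes "distinct [X, Y, Z]" "s Y = []"
  shows "runs g (transfer X Y Z) s (16 * length (s X) + 2) (s(X := [], Z := s X @ s Z))"
proof -
  have "runs g (transfer X Y Z) s (8 * length (s X) + 1 + (8 * length (s X) + 1))
      (s(X := [], Y := [], Z := s X @ s Z))"
    using runs_Seq[OF runs_pour[of X Y g s] runs_pour[of Y Z]] assms by (simp add: transfer_def)
  moreover have "s(X := [], Y := [], Z := s X @ s Z) = s(X := [], Z := s X @ s Z)"
    using assms by auto
  ultimately show ?thesis by simp
qed

primrec clear_stacks :: "nat list \<Rightarrow> prog" where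
  "clear_stacks [] = Skip"
| "clear_stacks (X # Xs) = Seq (Loop X (range Some) (Pop X)) (clear_stacks Xs)"

lemma runs_clear_stacks:
  assumes "\<forall>X\<in>set Xs. length (s X) \<le> b"
  shows "runs g (clear_stacks Xs) s (length Xs * (2 * b + 1) + 1)
    (\<lambda>X. if X \<in> set Xs then [] else s X)"
  using assms
proof (induction Xs arbitrary: s)
  case Nil
  then show ?case using runs_Skip[of g s] by simp
next
  case (Cons X Xs)
  define \<sigma> where "\<sigma> u v = s(X := v)" for u v :: word
  have "runs g (Pop X) (\<sigma> u (a # v)) 1 (\<sigma> (a # u) v)" for u a v
    using runs_Pop[of g X "\<sigma> u (a # v)"] by (simp add: \<sigma>_def)
  from runs_Loop_all[of \<sigma> X, OF _ this, of "s X"]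
  have "runs g (Loop X (range Some) (Pop X)) s (length (s X) + length (s X) + 1) (s(X := []))"
    by (simp add: \<sigma>_def mult_2_right)
  then have "runs g (Loop X (range Some) (Pop X)) s (2 * b + 1) (s(X := []))"
    using Cons.prems by (elim runs_mono) simp
  moreover have "runs g (clear_stacks Xs) (s(X := [])) (length Xs * (2 * b + 1) + 1)
      (\<lambda>Y. if Y \<in> set Xs then [] else (s(X := [])) Y)"
    using Cons.prems by (intro Cons.IH) simp
  moreover have "(\<lambda>Y. if Y \<in> set Xs then [] else (s(X := [])) Y) =
      (\<lambda>Y. if Y \<in> set (X # Xs) then [] else s Y)"
    by auto
  ultimately show ?case
    using runs_Seq by (fastforce simp: algebra_simps)
qed

lemma query_free_clear_stacks: "query_free (clear_stacks Xs)"
  by (induction Xs) auto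

section \<open>Subroutines\<close>

primrec stacks_below :: "prog \<Rightarrow> nat" where
  "stacks_below Skip = 0"
| "stacks_below (Push X a) = Suc X"
| "stacks_below (Pop X) = Suc X"
| "stacks_below (Query X) = Suc X"
| "stacks_below (Seq c1 c2) = max (stacks_below c1) (stacks_below c2)"
| "stacks_below (Branch X A c1 c2) = Max {Suc X, stacks_below c1, stacks_below c2}"
| "stacks_below (Loop X A c) = max (Suc X) (stacks_below c)"

lemma exec_unaffected: "exec g c s t s' \<Longrightarrow> stacks_below c \<le> i \<Longrightarrow> s' i = s i"
  by (induction rule: exec.induct) auto

lemma length_exec_le: "exec g c s t s' \<Longrightarrow> query_free c \<Longrightarrow> length (s' i) \<le> length (s i) + t"
  by (induction rule: exec.induct) (fastforce simp: le_diff_conv)+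

primrec shift_stacks :: "nat \<Rightarrow> prog \<Rightarrow> prog" where
  "shift_stacks N Skip = Skip"
| "shift_stacks N (Push X a) = Push (N + X) a"
| "shift_stacks N (Pop X) = Pop (N + X)"
| "shift_stacks N (Query X) = Query (N + X)"
| "shift_stacks N (Seq c1 c2) = Seq (shift_stacks N c1) (shift_stacks N c2)"
| "shift_stacks N (Branch X A c1 c2) = Branch (N + X) A (shift_stacks N c1) (shift_stacks N c2)"
| "shift_stacks N (Loop X A c) = Loop (N + X) A (shift_stacks N c)"

lemma query_free_shift_stacks: "query_free (shift_stacks N c) \<longleftrightarrow> query_free c"
  by (induction c) auto

definition join_states :: "nat \<Rightarrow> state \<Rightarrow> state \<Rightarrow> state" where
  "join_states N s u = (\<lambda>i. if i < N then s i else u (i - N))"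

lemma join_states_apply: "join_states N s u (N + X) = u X"
  by (simp add: join_states_def)

lemma join_states_upd: "(join_states N s u)(N + X := v) = join_states N s (u(X := v))"
  by (auto simp: join_states_def fun_eq_iff)

lemma exec_shift_stacks:
  assumes "exec h c u t u'" "query_free c"
  shows "exec g (shift_stacks N c) (join_states N s u) t (join_states N s u')"
proof -
  have top: "top_of (join_states N s u) (N + X) = top_of u X" for u X
    by (simp add: top_of_def join_states_apply)
  show ?thesis using assms
  proof (induction rule: exec.induct)
    case (Push X a u)
    show ?case using exec.Push[of g "N + X" a "join_states N s u"]
      by (simp add: join_states_apply join_states_upd del: fun_upd_apply)
  next
    case (Pop X u)
    show ?case using exec.Pop[of g "N + X" "join_states N s u"]
      by (simp add: join_states_apply join_states_upd del: fun_upd_apply)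
  qed (auto intro: exec.intros[simplified] simp: top)
qed

text \<open>Stack \<open>N\<close> is stack \<open>0\<close> of the shifted program, which reads its input and writes its output
  there. Stack \<open>N + 1\<close> only serves to keep the order of the symbols in a transfer.\<close>

definition subroutine :: "prog \<Rightarrow> nat \<Rightarrow> nat \<Rightarrow> prog" where
  "subroutine c X N =
     Seq (transfer X (N + 1) N)
    (Seq (shift_stacks N c)
    (Seq (clear_stacks [N + 1..<N + stacks_below c])
         (transfer N (N + 1) X)))"

lemma query_free_subroutine: "query_free c \<Longrightarrow> query_free (subroutine c X N)"
  by (simp add: subroutine_def transfer_def pour_def query_free_move_top query_free_shift_stacks
      query_free_clear_stacks)

lemma init_single: "init [x] = (\<lambda>_. [])(0 := x)"
  by (auto simp: init_def fun_eq_iff)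

lemma runs_transfer_join_states:
  assumes "X < N" "\<forall>i\<ge>N. s i = []"
  shows "runs g (transfer X (N + 1) N) s (16 * length (s X) + 2)
    (join_states N (s(X := [])) (init [s X]))"
proof -
  have "join_states N (s(X := [])) (init [s X]) = s(X := [], N := s X @ s N)"
    using assms by (auto simp: join_states_def init_single fun_eq_iff)
  then show ?thesis
    using runs_transfer[of X "N + 1" N s g] assms by simp
qed

lemma runs_clear_join_states:
  assumes "\<And>i. length (u i) \<le> l" "\<And>i. i \<ge> M \<Longrightarrow> i > 0 \<Longrightarrow> u i = []" and "\<forall>i\<ge>N. s i = []"
  shows "runs g (clear_stacks [N + 1..<N + M]) (join_states N s u) (M * (2 * l + 1) + 1)
    (s(N := u 0))"
proof -
  let ?Xs = "[N + 1..<N + M]"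
  have "runs g (clear_stacks ?Xs) (join_states N s u) (length ?Xs * (2 * l + 1) + 1)
      (\<lambda>i. if i \<in> set ?Xs then [] else join_states N s u i)"
    using assms(1) by (intro runs_clear_stacks) (simp add: join_states_def)
  also have "(\<lambda>i. if i \<in> set ?Xs then [] else join_states N s u i) = s(N := u 0)"
    using assms(2,3) by (auto simp: join_states_def fun_eq_iff)
  finally show ?thesis
    by (rule runs_mono) (intro add_mono mult_le_mono; simp)
qed

lemma length_output_le:
  assumes "query_free c" "outputs h c [x] b y"
  shows "length y \<le> length x + b"
proof -
  obtain t u where "exec h c (init [x]) t u" "t \<le> b" "u 0 = y"
    using assms(2) by (auto simp: outputs_def)
  then show ?thesis
    using length_exec_le[OF _ assms(1), of h "init [x]" t u 0] by (simp add: init_single)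
qed

lemma runs_subroutine:
  assumes c: "query_free c" "outputs h c [s X] b y"
    and X: "X < N" and empty: "\<forall>i\<ge>N. s i = []"
  shows "runs g (subroutine c X N) s ((stacks_below c + 17) * (2 * (length (s X) + b) + 2))
    (s(X := y))"
proof -
  define l where "l = length (s X) + b"
  let ?s = "s(X := [])" and ?M = "stacks_below c"
  obtain t u where exec: "exec h c (init [s X]) t u" and "t \<le> b" and y: "u 0 = y"
    using c(2) by (auto simp: outputs_def)
  have "length (u i) \<le> length (init [s X] i) + t" for i
    by (rule length_exec_le[OF exec c(1)])
  also have "length (init [s X] i) + t \<le> l" for i
    using \<open>t \<le> b\<close> by (simp add: init_single l_def)
  finally have len_u: "length (u i) \<le> l" for i .
  have u_empty: "u i = []" if "i \<ge> ?M" "i > 0" for i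
    using exec_unaffected[OF exec that(1)] that(2) by (simp add: init_single)
  have load: "runs g (transfer X (N + 1) N) s (16 * l + 2) (join_states N ?s (init [s X]))"
    using runs_transfer_join_states[OF X empty] by (rule runs_mono) (simp add: l_def)
  have run: "runs g (shift_stacks N c) (join_states N ?s (init [s X])) l (join_states N ?s u)"
    using exec_shift_stacks[OF exec c(1)] \<open>t \<le> b\<close> unfolding runs_def l_def
    by (meson trans_le_add2)
  have clear: "runs g (clear_stacks [N + 1..<N + ?M]) (join_states N ?s u)
      (?M * (2 * l + 1) + 1) (?s(N := y))"
    using runs_clear_join_states[of u l ?M N ?s g] len_u u_empty empty y by simp
  have unload: "runs g (transfer N (N + 1) X) (?s(N := y)) (16 * l + 2) (s(X := y))"
  proof -
    have "?s(N := [], X := y) = s(X := y)"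
      using X empty by auto
    then show ?thesis
      using runs_transfer[of N "N + 1" X "?s(N := y)" g] X empty len_u[of 0] y
      by (auto intro: runs_mono)
  qed
  have "16 * l + 2 + (l + (?M * (2 * l + 1) + 1 + (16 * l + 2))) \<le> (?M + 17) * (2 * l + 2)"
    by (simp add: algebra_simps)
  then show ?thesis
    using runs_Seq[OF load runs_Seq[OF run runs_Seq[OF clear unload]]]
    by (auto simp: subroutine_def l_def intro: runs_mono)
qed

section \<open>Polynomial-time computable word functions\<close>

definition polytime_computable :: "(word \<Rightarrow> word) \<Rightarrow> bool" where
  "polytime_computable f \<longleftrightarrow> (\<exists>c (p :: nat poly). query_free c \<and>
     (\<forall>x. outputs no_oracle c [x] (poly p (length x)) (f x)))"

text \<open>The stacks from \<open>N\<close> on are scratch space.\<close>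

definition computes_in_place :: "(nat \<Rightarrow> nat \<Rightarrow> prog) \<Rightarrow> (word \<Rightarrow> word) \<Rightarrow> nat poly \<Rightarrow> bool" where
  "computes_in_place R f r \<longleftrightarrow> (\<forall>X N. query_free (R X N)) \<and>
     (\<forall>x. length (f x) \<le> poly r (length x)) \<and>
     (\<forall>g X N s. X < N \<longrightarrow> (\<forall>i\<ge>N. s i = []) \<longrightarrow>
        runs g (R X N) s (poly r (length (s X))) (s(X := f (s X))))"

lemma computes_in_placeD:
  assumes "computes_in_place R f r"
  shows "query_free (R X N)" and "length (f x) \<le> poly r (length x)"
    and "X < N \<Longrightarrow> \<forall>i\<ge>N. s i = [] \<Longrightarrow> runs g (R X N) s (poly r (length (s X))) (s(X := f (s X)))"
  using assms unfolding computes_in_place_def by blast+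

lemma polytime_computable_in_place:
  assumes "polytime_computable f"
  shows "\<exists>R r. computes_in_place R f r"
proof -
  obtain c and p :: "nat poly" where c: "query_free c"
    "\<And>x. outputs no_oracle c [x] (poly p (length x)) (f x)"
    using assms by (auto simp: polytime_computable_def)
  define r where "r = of_nat (stacks_below c + 17) * (2 * ([:0, 1:] + p) + 2)"
  have r: "poly r n = (stacks_below c + 17) * (2 * (n + poly p n) + 2)" for n
    by (simp add: r_def)
  have "runs g (subroutine c X N) s (poly r (length (s X))) (s(X := f (s X)))"
    if "X < N" "\<forall>i\<ge>N. s i = []" for g X N s
    unfolding r by (rule runs_subroutine[OF c that])
  moreover have "length (f x) \<le> poly r (length x)" for x
  proof -
    have "length (f x) \<le> length x + poly p (length x)"
      by (rule length_output_le[OF c])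
    then show ?thesis by (simp add: r algebra_simps)
  qed
  ultimately show ?thesis
    using query_free_subroutine[OF c(1)] unfolding computes_in_place_def by blast
qed

section \<open>Reductions between search problems\<close>

definition search_reduction ::
  "(word \<Rightarrow> word) \<Rightarrow> (word \<Rightarrow> word \<Rightarrow> bool) \<Rightarrow> (word \<Rightarrow> word \<Rightarrow> bool) \<Rightarrow> bool" where
  "search_reduction f Q Q' \<longleftrightarrow>
     (\<forall>x y. Q x y \<longrightarrow> (\<exists>y'. Q' (f x) y') \<and> (\<forall>y'. Q' (f x) y' \<longrightarrow> Q x y'))"

lemma solves_search_reduction:
  "search_reduction f Q Q' \<Longrightarrow> solves g Q' \<Longrightarrow> solves (\<lambda>x. g (f x)) Q"
  unfolding search_reduction_def solves_def by blast

lemma poly_nat_mono: "x \<le> y \<Longrightarrow> poly p x \<le> poly p y" for p :: "nat poly"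
  by (induction p) (auto intro!: mult_mono)

lemma polytime_solvable_reduction:
  assumes "polytime_solvable Q'" "polytime_computable f" "search_reduction f Q Q'"
  shows "polytime_solvable Q"
proof -
  obtain c and p :: "nat poly" where c: "query_free c"
    and solve: "\<And>x y. Q' x y \<Longrightarrow> \<exists>y. outputs no_oracle c [x] (poly p (length x)) y \<and> Q' x y"
    using assms(1) unfolding polytime_solvable_def by blast
  obtain R r where R: "computes_in_place R f r"
    using polytime_computable_in_place[OF assms(2)] by blast
  have "\<exists>y. outputs no_oracle (Seq (R 0 1) c) [x] (poly (r + pcompose p r) (length x)) y \<and> Q x y"
    if xy: "Q x y" for x y
  proof -
    obtain y' where "Q' (f x) y'" and y': "Q x y'"
      and "outputs no_oracle c [f x] (poly p (length (f x))) y'"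
      using assms(3) xy solve unfolding search_reduction_def by meson
    then obtain s where s: "runs no_oracle c (init [f x]) (poly p (length (f x))) s" "s 0 = y'"
      by (auto simp: outputs_iff_runs)
    have "runs no_oracle (R 0 1) (init [x]) (poly r (length x)) (init [f x])"
      using computes_in_placeD(3)[OF R, of 0 1 "init [x]"] by (simp add: init_single)
    from runs_Seq[OF this s(1)]
    have "runs no_oracle (Seq (R 0 1) c) (init [x]) (poly (r + pcompose p r) (length x)) s"
      using poly_nat_mono[OF computes_in_placeD(2)[OF R], of p x]
      by (elim runs_mono) (simp add: poly_pcompose)
    then show ?thesis
      using s(2) y' unfolding outputs_iff_runs by blast
  qed
  then show ?thesis
    using computes_in_placeD(1)[OF R] c unfolding polytime_solvable_def by (metis query_free.simps(5))
qed

primrec precompose_queries :: "(nat \<Rightarrow> prog) \<Rightarrow> prog \<Rightarrow> prog" where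
  "precompose_queries R Skip = Skip"
| "precompose_queries R (Push X a) = Push X a"
| "precompose_queries R (Pop X) = Pop X"
| "precompose_queries R (Query X) = Seq (R X) (Query X)"
| "precompose_queries R (Seq c1 c2) = Seq (precompose_queries R c1) (precompose_queries R c2)"
| "precompose_queries R (Branch X A c1 c2) =
     Branch X A (precompose_queries R c1) (precompose_queries R c2)"
| "precompose_queries R (Loop X A c) = Loop X A (precompose_queries R c)"

text \<open>The queries of a run share its time \<open>t\<close>, so bounds on the single queries add up to a bound in
  terms of \<open>t\<close> if they are superadditive.\<close>

lemma runs_precompose_queries:
  fixes B :: "nat \<Rightarrow> nat"
  assumes superadditive: "\<And>a b. B a + B b \<le> B (a + b)" and "B 1 \<ge> 1"
    and query: "\<And>X s. X < N \<Longrightarrow> \<forall>i\<ge>N. s i = [] \<Longrightarrow>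
      runs g (Seq (R X) (Query X)) s (B (1 + length (s X) + length (g (f (s X)))))
        (s(X := g (f (s X))))"
    and "exec (\<lambda>x. g (f x)) c s t s'" "stacks_below c \<le> N" "\<forall>i\<ge>N. s i = []"
  shows "runs g (precompose_queries R c) s (B t) s'"
proof -
  have B_Suc: "1 + B t \<le> B (1 + t)" for t
    using superadditive[of 1 t] \<open>B 1 \<ge> 1\<close> by simp
  show ?thesis using assms(4-)
  proof (induction rule: exec.induct)
    case (Query X s)
    then show ?case using query by (simp del: fun_upd_apply)
  next
    case (Seq c1 s t1 s1 c2 t2 s2)
    have "\<forall>i\<ge>N. s1 i = []"
      using exec_unaffected[OF Seq.hyps(1)] Seq.prems by auto
    with Seq have "runs g (precompose_queries R (Seq c1 c2)) s (B t1 + B t2) s2"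
      by (auto intro: runs_Seq)
    then show ?case using superadditive runs_mono by blast
  next
    case (BranchT s X A c1 t s' c2)
    then have "runs g (precompose_queries R (Branch X A c1 c2)) s (1 + B t) s'"
      unfolding precompose_queries.simps by (intro runs_BranchT) auto
    then show ?case using B_Suc by (rule runs_mono)
  next
    case (BranchF s X A c2 t s' c1)
    then have "runs g (precompose_queries R (Branch X A c1 c2)) s (1 + B t) s'"
      unfolding precompose_queries.simps by (intro runs_BranchF) auto
    then show ?case using B_Suc by (rule runs_mono)
  next
    case (LoopT s X A c t1 s1 t2 s2)
    have "\<forall>i\<ge>N. s1 i = []"
      using exec_unaffected[OF LoopT.hyps(2)] LoopT.prems by auto
    with LoopT have "runs g (precompose_queries R (Loop X A c)) s (1 + B t1 + B t2) s2"
      unfolding precompose_queries.simps by (intro runs_LoopT) auto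
    moreover have "1 + B t1 + B t2 \<le> B (1 + t1 + t2)"
      using B_Suc[of t1] superadditive[of "1 + t1" t2] by simp
    ultimately show ?case by (rule runs_mono)
  qed (use \<open>B 1 \<ge> 1\<close> in \<open>simp_all add: runs_mono[OF runs_Skip] runs_mono[OF runs_Push]
      runs_mono[OF runs_Pop] runs_mono[OF runs_LoopF] del: fun_upd_apply\<close>)
qed

lemma mult_poly_superadditive:
  "a * poly w a + b * poly w b \<le> (a + b) * poly w (a + b)" for w :: "nat poly"
  using poly_nat_mono[of a "a + b" w] poly_nat_mono[of b "a + b" w]
  by (auto simp: distrib_right intro!: add_mono)

lemma runs_in_place_Query:
  assumes R: "computes_in_place R f r" and "X < N" "\<forall>i\<ge>N. s i = []"
    and t: "t = 1 + length (s X) + length (g (f (s X)))"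
  shows "runs g (Seq (R X N) (Query X)) s (t * poly (2 * r + 2) t) (s(X := g (f (s X))))"
proof -
  have "runs g (Seq (R X N) (Query X)) s
      (poly r (length (s X)) + (1 + length (f (s X)) + length (g (f (s X))))) (s(X := g (f (s X))))"
    using runs_Seq[OF computes_in_placeD(3)[OF assms(1-3)] runs_Query[of g X]] by simp
  then show ?thesis
  proof (rule runs_mono)
    have "poly r (length (s X)) \<le> poly r t"
      by (rule poly_nat_mono) (simp add: t)
    then have "poly r (length (s X)) + (1 + length (f (s X)) + length (g (f (s X))))
        \<le> 2 * poly r t + t"
      using computes_in_placeD(2)[OF R, of "s X"] by (simp add: t)
    also have "\<dots> \<le> t * (2 * poly r t) + t * 2"
      by (intro add_mono) (auto simp: t)
    finally show "poly r (length (s X)) + (1 + length (f (s X)) + length (g (f (s X))))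
        \<le> t * poly (2 * r + 2) t"
      by (simp add: algebra_simps)
  qed
qed

lemma polytime_precompose_queries:
  assumes "polytime_computable f"
  shows "\<exists>c' (w :: nat poly). \<forall>g x t y.
    outputs (\<lambda>x. g (f x)) c [x] t y \<longrightarrow> outputs g c' [x] (t * poly w t) y"
proof -
  obtain R r where R: "computes_in_place R f r"
    using polytime_computable_in_place[OF assms] by blast
  define N where "N = max 1 (stacks_below c)"
  define w where "w = 2 * r + 2"
  define B where "B t = t * poly w t" for t
  have superadditive: "B a + B b \<le> B (a + b)" for a b
    unfolding B_def by (rule mult_poly_superadditive)
  have query: "runs g (Seq (R X N) (Query X)) s (B (1 + length (s X) + length (g (f (s X)))))
      (s(X := g (f (s X))))" if "X < N" "\<forall>i\<ge>N. s i = []" for g X s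
    unfolding B_def w_def by (rule runs_in_place_Query[OF R that refl])
  show ?thesis
  proof (intro exI allI impI)
    fix g x t y assume "outputs (\<lambda>x. g (f x)) c [x] t y"
    then obtain t' s where exec: "exec (\<lambda>x. g (f x)) c (init [x]) t' s" and "t' \<le> t" "s 0 = y"
      by (auto simp: outputs_def)
    have "runs g (precompose_queries (\<lambda>X. R X N) c) (init [x]) (B t') s"
      by (rule runs_precompose_queries[OF superadditive _ query exec])
        (auto simp: B_def w_def N_def init_single)
    moreover have "B t' \<le> t * poly w t"
      unfolding B_def using \<open>t' \<le> t\<close> by (intro mult_mono poly_nat_mono) auto
    ultimately show "outputs g (precompose_queries (\<lambda>X. R X N) c) [x] (t * poly w t) y"
      using \<open>s 0 = y\<close> runs_mono unfolding outputs_iff_runs by blast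
  qed
qed

lemma NP_hard_reduction:
  assumes "NP_hard A" "polytime_computable f"
    and "search_reduction f (optimal_answer A) (optimal_answer B)"
  shows "NP_hard B"
  unfolding NP_hard_def
proof
  fix L assume "L \<in> class_NP"
  with assms(1) obtain c and p :: "nat poly" where decide: "\<And>g x. solves g (optimal_answer A) \<Longrightarrow>
      outputs g c [x] (poly p (length x)) (verdict (x \<in> L))"
    unfolding NP_hard_def by blast
  obtain c' and w :: "nat poly" where c': "\<And>g x t y.
      outputs (\<lambda>x. g (f x)) c [x] t y \<Longrightarrow> outputs g c' [x] (t * poly w t) y"
    using polytime_precompose_queries[OF assms(2), of c] by blast
  have "outputs g c' [x] (poly (p * pcompose w p) (length x)) (verdict (x \<in> L))"
    if "solves g (optimal_answer B)" for g x
    using c'[OF decide[OF solves_search_reduction[OF assms(3) that]]] by (simp add: poly_pcompose)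
  then show "\<exists>c (p :: nat poly). \<forall>g. solves g (optimal_answer B) \<longrightarrow>
      (\<forall>x. outputs g c [x] (poly p (length x)) (verdict (x \<in> L)))"
    by blast
qed

definition answer_satisfying ::
  "('i, 's) min_problem \<Rightarrow> ('i \<Rightarrow> 's \<Rightarrow> bool) \<Rightarrow> word \<Rightarrow> word \<Rightarrow> bool" where
  "answer_satisfying A \<Phi> x y \<longleftrightarrow> (\<exists>I \<in> instances A. \<exists>S \<in> solutions A I.
     x = enc_instance A I \<and> y = enc_solution A S \<and> \<Phi> I S)"

lemma optimal_answer_eq:
  "optimal_answer A = answer_satisfying A (\<lambda>I S. objective A I S = opt_value A I)"
  by (simp add: fun_eq_iff optimal_answer_def answer_satisfying_def)

lemma approx_answer_eq:
  "approx_answer \<rho> A = answer_satisfying A (\<lambda>I S. objective A I S \<le> \<rho> * opt_value A I)"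
  by (simp add: fun_eq_iff approx_answer_def answer_satisfying_def)

lemma eq_opt_value_iff:
  assumes "finite (solutions A I)" "S \<in> solutions A I"
  shows "objective A I S = opt_value A I \<longleftrightarrow> (\<forall>S'\<in>solutions A I. objective A I S \<le> objective A I S')"
proof -
  have "Min (objective A I ` solutions A I) = objective A I S \<longleftrightarrow>
      (\<forall>S'\<in>solutions A I. objective A I S \<le> objective A I S')"
    using assms by (subst Min_eq_iff) auto
  then show ?thesis by (auto simp: opt_value_def)
qed

locale instance_reduction =
  fixes A :: "('i, 's) min_problem" and B :: "('j, 's) min_problem"
    and f :: "word \<Rightarrow> word" and F :: "'i \<Rightarrow> 'j"
  assumes polytime: "polytime_computable f"
    and in_instances: "\<And>I. I \<in> instances A \<Longrightarrow> F I \<in> instances B"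
    and enc_instance_eq: "\<And>I. I \<in> instances A \<Longrightarrow> enc_instance B (F I) = f (enc_instance A I)"
    and inj_enc_instance: "inj_on (enc_instance B) (instances B)"
    and solutions_eq: "\<And>I. I \<in> instances A \<Longrightarrow> solutions B (F I) = solutions A I"
    and enc_solution_eq: "enc_solution B = enc_solution A"
begin

lemma search_reduction_answer_satisfying:
  assumes iff: "\<And>I S. I \<in> instances A \<Longrightarrow> S \<in> solutions A I \<Longrightarrow> \<Psi> (F I) S \<longleftrightarrow> \<Phi> I S"
  shows "search_reduction f (answer_satisfying A \<Phi>) (answer_satisfying B \<Psi>)"
  unfolding search_reduction_def
proof (intro allI impI conjI)
  fix x y assume "answer_satisfying A \<Phi> x y"
  then obtain I S where I: "I \<in> instances A" "x = enc_instance A I" and S: "S \<in> solutions A I" "\<Phi> I S"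
    by (auto simp: answer_satisfying_def)
  then have "answer_satisfying B \<Psi> (f x) (enc_solution B S)"
    unfolding answer_satisfying_def using in_instances enc_instance_eq solutions_eq iff by metis
  then show "\<exists>y'. answer_satisfying B \<Psi> (f x) y'" ..
  fix y' assume "answer_satisfying B \<Psi> (f x) y'"
  then obtain J S' where J: "J \<in> instances B" "f x = enc_instance B J"
      and S': "S' \<in> solutions B J" "y' = enc_solution B S'" "\<Psi> J S'"
    by (auto simp: answer_satisfying_def)
  from I J have "J = F I"
    using inj_enc_instance in_instances enc_instance_eq by (metis inj_onD)
  then show "answer_satisfying A \<Phi> x y'"
    unfolding answer_satisfying_def using I S' solutions_eq iff enc_solution_eq by metis
qed

lemma NP_hard_if_order_preserving:
  assumes "NP_hard A"
    and finite: "\<And>I. I \<in> instances A \<Longrightarrow> finite (solutions A I)"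
    and order: "\<And>I S S'. I \<in> instances A \<Longrightarrow> S \<in> solutions A I \<Longrightarrow> S' \<in> solutions A I \<Longrightarrow>
      objective B (F I) S \<le> objective B (F I) S' \<longleftrightarrow> objective A I S \<le> objective A I S'"
  shows "NP_hard B"
proof (rule NP_hard_reduction[OF assms(1) polytime])
  have "objective B (F I) S = opt_value B (F I) \<longleftrightarrow> objective A I S = opt_value A I"
    if "I \<in> instances A" "S \<in> solutions A I" for I S
    using that finite order by (simp add: eq_opt_value_iff solutions_eq)
  then show "search_reduction f (optimal_answer A) (optimal_answer B)"
    unfolding optimal_answer_eq by (rule search_reduction_answer_satisfying)
qed

lemma hard_to_approximate_if_objective_preserving:
  assumes "hard_to_approximate \<rho> A"
    and objective: "\<And>I S. I \<in> instances A \<Longrightarrow> S \<in> solutions A I \<Longrightarrow>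
      objective B (F I) S = objective A I S"
  shows "hard_to_approximate \<rho> B"
proof -
  have "opt_value B (F I) = opt_value A I" if "I \<in> instances A" for I
    using that by (simp add: opt_value_def solutions_eq objective)
  then have "search_reduction f (approx_answer \<rho> A) (approx_answer \<rho> B)"
    unfolding approx_answer_eq by (intro search_reduction_answer_satisfying) (simp add: objective)
  then show ?thesis
    using assms(1) polytime polytime_solvable_reduction unfolding hard_to_approximate_def by blast
qed

end

section \<open>Unique decoding\<close>

definition prefix_code_on :: "'a set \<Rightarrow> ('a \<Rightarrow> word) \<Rightarrow> bool" where
  "prefix_code_on A e \<longleftrightarrow> (\<forall>x\<in>A. \<forall>y\<in>A. \<forall>u v. e x @ u = e y @ v \<longrightarrow> x = y \<and> u = v)"

lemma prefix_code_onI: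
  "(\<And>x y u v. x \<in> A \<Longrightarrow> y \<in> A \<Longrightarrow> e x @ u = e y @ v \<Longrightarrow> x = y \<and> u = v) \<Longrightarrow> prefix_code_on A e"
  unfolding prefix_code_on_def by blast

lemma prefix_code_onD:
  "prefix_code_on A e \<Longrightarrow> e x @ u = e y @ v \<Longrightarrow> x \<in> A \<Longrightarrow> y \<in> A \<Longrightarrow> x = y \<and> u = v"
  unfolding prefix_code_on_def by blast

lemma prefix_code_on_imp_inj_on: "prefix_code_on A e \<Longrightarrow> inj_on e A"
  by (rule inj_onI) (metis prefix_code_onD)

lemma prefix_code_on_comp:
  "prefix_code_on B e \<Longrightarrow> inj_on f A \<Longrightarrow> f ` A \<subseteq> B \<Longrightarrow> prefix_code_on A (\<lambda>x. e (f x))"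
  unfolding prefix_code_on_def inj_on_def by blast

lemma prefix_code_on_pair:
  assumes "prefix_code_on A e" "prefix_code_on B f"
  shows "prefix_code_on (A \<times> B) (\<lambda>(x, y). e x @ f y)"
proof (rule prefix_code_onI, clarsimp)
  fix x y x' y' u v
  assume "x \<in> A" "y \<in> B" "x' \<in> A" "y' \<in> B" "e x @ f y @ u = e x' @ f y' @ v"
  then show "x = x' \<and> y = y' \<and> u = v"
    using prefix_code_onD[OF assms(1), of x _ x'] prefix_code_onD[OF assms(2), of y u y' v] by blast
qed

lemma prefix_code_on_terminated:
  assumes "inj_on e A" "\<And>x. x \<in> A \<Longrightarrow> c \<notin> set (e x)"
  shows "prefix_code_on A (\<lambda>x. e x @ [c])"
proof (rule prefix_code_onI)
  fix x y u v assume x: "x \<in> A" and y: "y \<in> A" and eq: "(e x @ [c]) @ u = (e y @ [c]) @ v"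
  have "takeWhile (\<lambda>a. a \<noteq> c) (e z @ c # w) = e z" if "z \<in> A" for z w
    using assms(2)[OF that] by (subst takeWhile_append2) auto
  from this[OF x, of u] this[OF y, of v] eq have "e x = e y" by simp
  with eq show "x = y \<and> u = v" using inj_onD[OF assms(1) _ x y] by simp
qed

lemma prefix_code_on_enc_list:
  assumes code: "prefix_code_on A e" and ne: "\<And>x. x \<in> A \<Longrightarrow> e x \<noteq> [] \<and> hd (e x) \<noteq> Close"
  shows "prefix_code_on (lists A) (enc_list e)"
proof (rule prefix_code_onI)
  fix xs ys u v
  assume "xs \<in> lists A" "ys \<in> lists A" "enc_list e xs @ u = enc_list e ys @ v"
  then have "concat (map e xs) @ Close # u = concat (map e ys) @ Close # v"
    by (simp add: enc_list_def)
  then show "xs = ys \<and> u = v"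
    using \<open>xs \<in> lists A\<close> \<open>ys \<in> lists A\<close>
  proof (induction xs arbitrary: ys)
    case Nil
    show ?case
    proof (cases ys)
      case (Cons y ys')
      then show ?thesis using Nil ne[of y] by (cases "e y") auto
    qed (use Nil in auto)
  next
    case (Cons x xs)
    show ?case
    proof (cases ys)
      case Nil
      then show ?thesis using Cons.prems ne[of x] by (cases "e x") auto
    next
      case (Cons y ys')
      then have "x = y" "concat (map e xs) @ Close # u = concat (map e ys') @ Close # v"
        using prefix_code_onD[OF code, of x "concat (map e xs) @ Close # u" y
            "concat (map e ys') @ Close # v"] Cons.prems by auto
      then show ?thesis using Cons.IH[of ys'] Cons.prems Cons by auto
    qed
  qed
qed

lemma horner_sum_bits: "horner_sum of_bool 2 (bits n) = n"
proof (induction n rule: bits.induct)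
  case (1 n)
  then show ?case
    by (cases "n = 0"; cases "odd n") (simp_all add: bits.simps[of n] bits.simps[of 0])
qed

lemma inj_bits: "inj bits"
  by (rule inj_on_inverseI) (rule horner_sum_bits)

lemma less_two_power_length_bits: "n < 2 ^ length (bits n)"
  using horner_sum_bound[where 'a = nat, of "bits n"] by (simp add: horner_sum_bits)

lemma bits_two_power: "bits (2 ^ k) = replicate k False @ [True]"
proof (induction k)
  case 0
  show ?case by (simp add: bits.simps[of "Suc 0"] bits.simps[of 0])
next
  case (Suc k)
  then show ?case by (subst bits.simps) simp
qed

lemma prefix_code_on_enc_nat: "prefix_code_on UNIV enc_nat"
proof -
  have "inj (\<lambda>n. map Digit (bits n))"
    using inj_bits by (auto simp: inj_def dest: map_injective)
  then have "prefix_code_on UNIV (\<lambda>n. map Digit (bits n) @ [Sep])"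
    by (rule prefix_code_on_terminated) auto
  then show ?thesis by (simp add: enc_nat_def[abs_def])
qed

lemma hd_enc_nat: "enc_nat n @ w \<noteq> [] \<and> hd (enc_nat n @ w) \<noteq> Close"
  by (cases "bits n") (auto simp: enc_nat_def)

lemma quotient_of_nonneg: "0 \<le> r \<Longrightarrow> 0 \<le> fst (quotient_of r)"
  by (simp add: rat_less_eq_code case_prod_beta)

lemma prefix_code_on_enc_rat: "prefix_code_on {0..} enc_rat"
proof -
  let ?fraction = "\<lambda>r. (nat (fst (quotient_of r)), nat (snd (quotient_of r)))"
  have "inj_on ?fraction {0..}"
  proof (rule inj_onI)
    fix r r' :: rat assume "r \<in> {0..}" "r' \<in> {0..}" "?fraction r = ?fraction r'"
    then have "quotient_of r = quotient_of r'"
      using quotient_of_nonneg quotient_of_denom_pos'[of r] quotient_of_denom_pos'[of r']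
      by (auto simp: prod_eq_iff eq_nat_nat_iff less_imp_le)
    then show "r = r'" by (simp add: quotient_of_inject_eq)
  qed
  note code_comp = prefix_code_on_comp[OF _ this]
  from code_comp[OF prefix_code_on_pair[OF prefix_code_on_enc_nat prefix_code_on_enc_nat]]
  show ?thesis by (simp add: enc_rat_def[abs_def])
qed

lemma hd_enc_rat: "enc_rat r @ w \<noteq> [] \<and> hd (enc_rat r @ w) \<noteq> Close"
  using hd_enc_nat by (simp add: enc_rat_def)

definition enc_prec :: "nat \<times> nat \<Rightarrow> word" where
  "enc_prec = (\<lambda>(i, j). enc_nat i @ enc_nat j)"

definition enc_job :: "rat \<times> rat \<Rightarrow> word" where
  "enc_job = (\<lambda>(p, d). enc_rat p @ enc_rat d)"

lemma enc_uncertain_eq: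
  "enc_uncertain I = replicate (njobs I) (Digit True) @ Sep #
     enc_list enc_prec (precs I) @ enc_list (enc_list enc_job) (scenarios I)"
  by (simp add: enc_uncertain_def enc_prec_def enc_job_def)

lemma prefix_code_on_enc_uncertain:
  "prefix_code_on {I. scenarios I \<in> lists (lists ({0..} \<times> {0..}))} enc_uncertain"
proof -
  let ?A = "lists (lists ({0..} \<times> {0..})) :: scenario list set"
  let ?tuple = "\<lambda>I :: uncertain_instance. (njobs I, precs I, scenarios I)"
  let ?code = "\<lambda>(n, z). (replicate n (Digit True) @ [Sep]) @
    (case z of (ps, \<xi>s) \<Rightarrow> enc_list enc_prec ps @ enc_list (enc_list enc_job) \<xi>s)"
  have "inj (\<lambda>n. replicate n (Digit True))"
    by (rule inj_on_inverseI[of _ length]) simp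
  then have "prefix_code_on UNIV (\<lambda>n. replicate n (Digit True) @ [Sep])"
    by (rule prefix_code_on_terminated) auto
  moreover have "prefix_code_on (lists (UNIV \<times> UNIV)) (enc_list enc_prec)"
    unfolding enc_prec_def using hd_enc_nat
    by (intro prefix_code_on_enc_list prefix_code_on_pair prefix_code_on_enc_nat) auto
  moreover have "prefix_code_on ?A (enc_list (enc_list enc_job))"
    unfolding enc_job_def using hd_enc_rat
    by (intro prefix_code_on_enc_list prefix_code_on_pair prefix_code_on_enc_rat)
      (auto simp: enc_list_def)
  ultimately have "prefix_code_on (UNIV \<times> lists (UNIV \<times> UNIV) \<times> ?A) ?code"
    by (intro prefix_code_on_pair)
  moreover have "inj_on ?tuple {I. scenarios I \<in> ?A}"
    by (intro inj_onI uncertain_instance.equality) auto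
  moreover have "?tuple ` {I. scenarios I \<in> ?A} \<subseteq> UNIV \<times> lists (UNIV \<times> UNIV) \<times> ?A"
    by auto
  ultimately have "prefix_code_on {I. scenarios I \<in> ?A} (\<lambda>I. ?code (?tuple I))"
    by (rule prefix_code_on_comp)
  then show ?thesis by (simp add: enc_uncertain_eq[abs_def])
qed

lemma inj_on_enc_stochastic: "inj_on enc_stochastic (stochastic_instances P K)"
proof -
  have "prefix_code_on (lists {0..}) (enc_list enc_rat)"
    using hd_enc_rat[of _ "[]"] by (intro prefix_code_on_enc_list prefix_code_on_enc_rat) auto
  note code = prefix_code_on_pair[OF this prefix_code_on_enc_uncertain]
  have "prefix_code_on (stochastic_instances P K) enc_stochastic"
    using prefix_code_on_comp[OF code, of prod.swap "stochastic_instances P K"]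
    by (fastforce simp: enc_stochastic_def[abs_def] case_prod_beta stochastic_instances_def
        uncertain_instances_def valid_scenario_def less_imp_le)
  then show ?thesis by (rule prefix_code_on_imp_inj_on)
qed

section \<open>Appending a scenario to an encoded instance\<close>

definition time_exponent :: "bool \<Rightarrow> word \<Rightarrow> nat" where
  "time_exponent unit x = (if unit then 0 else length x)"

lemma time_exponent_rev: "time_exponent u (rev x) = time_exponent u x"
  by (simp add: time_exponent_def)

definition added_job_word :: "nat \<Rightarrow> word" where
  "added_job_word k = enc_job (2 ^ k, 0)"

lemma added_job_word_eq: "added_job_word k = replicate k (Digit False) @ added_job_word 0"
proof -
  have "quotient_of (2 ^ k) = (2 ^ k, 1)" for k
    using quotient_of_rat_of_int[of "2 ^ k"] by simp
  then have "enc_rat (2 ^ k) = map Digit (replicate k False @ [True]) @ Sep # enc_nat 1" for k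
    by (simp add: enc_rat_def enc_nat_def bits_two_power nat_power_eq)
  from this[of k] this[of 0] show ?thesis
    by (simp add: added_job_word_def enc_job_def)
qed

definition leading_ones :: "word \<Rightarrow> word" where
  "leading_ones x = takeWhile (\<lambda>a. a = Digit True) x"

text \<open>The leading digits of an encoded instance count the jobs in unary, and its last symbol closes
  the list of scenarios.\<close>

definition append_scenario_word :: "word \<Rightarrow> bool \<Rightarrow> word \<Rightarrow> word" where
  "append_scenario_word w unit x = w @ butlast x @
     enc_list added_job_word (replicate (length (leading_ones x)) (time_exponent unit x)) @ [Close]"

definition move_prefix :: "sym \<Rightarrow> nat \<Rightarrow> nat \<Rightarrow> nat \<Rightarrow> prog" where
  "move_prefix a X Y Z = Loop X {Some a} (Seq (move_top X Y) (Push Z a))"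

lemma runs_move_prefix:
  fixes s :: state and a :: sym
  assumes "distinct [X, Y, Z]"
  defines "u \<equiv> takeWhile (\<lambda>b. b = a) (s X)" and "v \<equiv> dropWhile (\<lambda>b. b = a) (s X)"
  shows "runs g (move_prefix a X Y Z) s (9 * length u + 1)
    (s(X := v, Y := rev u @ s Y, Z := rev u @ s Z))"
proof -
  define \<sigma> where "\<sigma> u v = s(X := v, Y := u @ s Y, Z := u @ s Z)" for u v
  have "runs g (Seq (move_top X Y) (Push Z a)) (\<sigma> u (b # v)) 8 (\<sigma> (b # u) v)"
    if "b \<in> {a}" for u b v
  proof -
    have "(\<sigma> u (b # v))(X := v, Y := b # u @ s Y, Z := a # u @ s Z) = \<sigma> (b # u) v"
      using assms(1) that by (auto simp: \<sigma>_def fun_eq_iff)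
    then show ?thesis
      using runs_Seq[OF runs_move_top[of "\<sigma> u (b # v)" X b v Y] runs_Push[of g Z a]] assms(1)
      by (simp add: \<sigma>_def)
  qed
  from runs_Loop_takeWhile[of \<sigma> X "{a}", OF _ this, of "[]" "s X"] assms(1) show ?thesis
    by (simp add: u_def v_def move_prefix_def \<sigma>_def mult.commute)
qed

definition push_per_symbol :: "sym \<Rightarrow> nat \<Rightarrow> nat \<Rightarrow> nat \<Rightarrow> prog" where
  "push_per_symbol a X Y Z =
     Seq (Loop Y (range Some) (Seq (move_top Y Z) (Push X a))) (pour Z Y)"

lemma runs_push_per_symbol:
  assumes "distinct [X, Y, Z]" "s Z = []"
  shows "runs g (push_per_symbol a X Y Z) s (17 * length (s Y) + 2)
    (s(X := replicate (length (s Y)) a @ s X))"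
proof -
  define \<sigma> where "\<sigma> u v = s(Y := v, Z := u @ s Z, X := replicate (length u) a @ s X)" for u v
  have "runs g (Seq (move_top Y Z) (Push X a)) (\<sigma> u (b # v)) 8 (\<sigma> (b # u) v)" for u b v
  proof -
    have "(\<sigma> u (b # v))(Y := v, Z := b # u @ s Z, X := a # replicate (length u) a @ s X) =
        \<sigma> (b # u) v"
      using assms(1) by (auto simp: \<sigma>_def fun_eq_iff)
    then show ?thesis
      using runs_Seq[OF runs_move_top[of "\<sigma> u (b # v)" Y b v Z] runs_Push[of g X a]] assms(1)
      by (simp add: \<sigma>_def)
  qed
  moreover have "\<sigma> [] (s Y) = s"
    by (simp add: \<sigma>_def)
  ultimately
  have count: "runs g (Loop Y (range Some) (Seq (move_top Y Z) (Push X a))) s (9 * length (s Y) + 1)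
      (\<sigma> (rev (s Y)) [])"
    using runs_Loop_all[of \<sigma> Y, of g _ 8 "s Y"] assms(1) by (simp add: \<sigma>_def mult.commute)
  have restore: "(\<sigma> (rev (s Y)) [])(Z := [], Y := s Y) = s(X := replicate (length (s Y)) a @ s X)"
    using assms by (auto simp: \<sigma>_def fun_eq_iff)
  have "runs g (pour Z Y) (\<sigma> (rev (s Y)) []) (8 * length (s Y) + 1)
      (s(X := replicate (length (s Y)) a @ s X))"
    using runs_pour[of Z Y g "\<sigma> (rev (s Y)) []"] restore assms by (simp add: \<sigma>_def)
  from runs_Seq[OF count this] show ?thesis
    unfolding push_per_symbol_def by (rule runs_mono) simp
qed

definition push_job :: "bool \<Rightarrow> prog" where
  "push_job unit = Seq (push_word 0 (added_job_word 0))
     (if unit then Skip else push_per_symbol (Digit False) 0 1 2)"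

lemma runs_push_job:
  assumes "s 2 = []"
  shows "runs g (push_job u) s (length (added_job_word 0) + 17 * length (s 1) + 3)
    (s(0 := added_job_word (time_exponent u (s 1)) @ s 0))"
proof -
  let ?s = "s(0 := added_job_word 0 @ s 0)"
  have "runs g (if u then Skip else push_per_symbol (Digit False) 0 1 2) ?s (17 * length (s 1) + 2)
      (s(0 := added_job_word (time_exponent u (s 1)) @ s 0))"
  proof (cases u)
    case True
    then show ?thesis
      using runs_Skip[of g ?s] by (auto simp: time_exponent_def intro: runs_mono)
  next
    case False
    then show ?thesis
      using runs_push_per_symbol[of 0 1 2 ?s g "Digit False"] assms
      by (simp add: time_exponent_def added_job_word_eq[of "length (s 1)"] del: One_nat_def)
  qed
  from runs_Seq[OF runs_push_word this] show ?thesis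
    unfolding push_job_def by (rule runs_mono) simp
qed

lemma runs_push_jobs:
  assumes "s 2 = []"
  shows "runs g (Loop 3 (range Some) (Seq (Pop 3) (push_job u))) s
    (length (s 3) * (length (added_job_word 0) + 17 * length (s 1) + 5) + 1)
    (s(3 := [],
       0 := concat (map added_job_word (replicate (length (s 3)) (time_exponent u (s 1)))) @ s 0))"
proof -
  let ?jobs = "\<lambda>n. concat (map added_job_word (replicate n (time_exponent u (s 1))))"
  define \<sigma> where "\<sigma> v w = s(3 := w, 0 := ?jobs (length v) @ s 0)" for v w :: word
  have "runs g (Seq (Pop 3) (push_job u)) (\<sigma> v (a # w))
      (length (added_job_word 0) + 17 * length (s 1) + 4) (\<sigma> (a # v) w)" for v a w
  proof -
    let ?t = "(\<sigma> v (a # w))(3 := w)"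
    have "runs g (Pop 3) (\<sigma> v (a # w)) 1 ?t"
      using runs_Pop[of g 3 "\<sigma> v (a # w)"] by (simp add: \<sigma>_def)
    moreover have "runs g (push_job u) ?t (length (added_job_word 0) + 17 * length (s 1) + 3)
        (\<sigma> (a # v) w)"
    proof -
      have "?t 2 = []" "?t 1 = s 1"
        using assms by (simp_all add: \<sigma>_def)
      moreover have "?t(0 := added_job_word (time_exponent u (s 1)) @ ?t 0) = \<sigma> (a # v) w"
        by (auto simp: \<sigma>_def fun_eq_iff)
      ultimately show ?thesis
        using runs_push_job[of ?t g u] by (simp only:)
    qed
    ultimately show ?thesis
      by (rule runs_mono[OF runs_Seq]) simp
  qed
  from runs_Loop_all[of \<sigma> 3, OF _ this, of "s 3"] show ?thesis
    by (simp add: \<sigma>_def ac_simps)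
qed

definition push_scenario :: "bool \<Rightarrow> prog" where
  "push_scenario unit =
     Seq (Push 0 Close) (Seq (Loop 3 (range Some) (Seq (Pop 3) (push_job unit))) (Push 0 Open))"

lemma runs_push_scenario:
  assumes "s 2 = []"
  shows "runs g (push_scenario u) s
    (length (s 3) * (length (added_job_word 0) + 17 * length (s 1) + 5) + 3)
    (s(3 := [],
       0 := enc_list added_job_word (replicate (length (s 3)) (time_exponent u (s 1))) @ s 0))"
proof -
  let ?s = "s(0 := Close # s 0)"
  let ?jobs = "concat (map added_job_word (replicate (length (s 3)) (time_exponent u (s 1))))"
  have "runs g (Push 0 Close) s 1 ?s"
    by (rule runs_Push)
  moreover have "runs g (Loop 3 (range Some) (Seq (Pop 3) (push_job u))) ?s
      (length (s 3) * (length (added_job_word 0) + 17 * length (s 1) + 5) + 1)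
      (s(3 := [], 0 := ?jobs @ Close # s 0))"
  proof -
    have "?s(3 := [], 0 := ?jobs @ Close # s 0) = s(3 := [], 0 := ?jobs @ Close # s 0)"
      by auto
    then show ?thesis
      using runs_push_jobs[of ?s g u] assms by simp
  qed
  moreover have "runs g (Push 0 Open) (s(3 := [], 0 := ?jobs @ Close # s 0)) 1
      (s(3 := [], 0 := Open # ?jobs @ Close # s 0))"
    using runs_Push[of g 0 Open "s(3 := [], 0 := ?jobs @ Close # s 0)"] by simp
  ultimately have "runs g (push_scenario u) s
      (1 + (length (s 3) * (length (added_job_word 0) + 17 * length (s 1) + 5) + 1 + 1))
      (s(3 := [], 0 := Open # ?jobs @ Close # s 0))"
    unfolding push_scenario_def by (intro runs_Seq)
  then show ?thesis by (auto simp: enc_list_def elim: runs_mono)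
qed

definition reverse_input :: prog where
  "reverse_input = Seq (move_prefix (Digit True) 0 1 3) (pour 0 1)"

lemma runs_reverse_input:
  "runs g reverse_input (init [x]) (9 * length x + 2)
    ((\<lambda>_. [])(1 := rev x, 3 := rev (leading_ones x)))"
proof -
  define u v where "u = leading_ones x" and "v = dropWhile (\<lambda>a. a = Digit True) x"
  have x: "x = u @ v"
    by (simp add: u_def v_def leading_ones_def)
  let ?s = "(\<lambda>_. [])(0 := v, 1 := rev u, 3 := rev u) :: state"
  have "runs g (move_prefix (Digit True) 0 1 3) (init [x]) (9 * length u + 1) ?s"
    using runs_move_prefix[of 0 1 3 g "Digit True" "init [x]"]
    by (simp add: init_single u_def v_def leading_ones_def)
  moreover have "runs g (pour 0 1) ?s (8 * length v + 1) ((\<lambda>_. [])(1 := rev x, 3 := rev u))"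
  proof -
    have "?s(0 := [], 1 := rev v @ rev u) = (\<lambda>_. [])(1 := rev x, 3 := rev u)"
      by (auto simp: x)
    then show ?thesis
      using runs_pour[of 0 1 g ?s] by simp
  qed
  ultimately have "runs g reverse_input (init [x]) (9 * length u + 1 + (8 * length v + 1))
      ((\<lambda>_. [])(1 := rev x, 3 := rev u))"
    unfolding reverse_input_def by (rule runs_Seq)
  then show ?thesis
    unfolding u_def[symmetric] by (rule runs_mono) (simp add: x)
qed

definition restore_input :: "word \<Rightarrow> prog" where
  "restore_input w = Seq (Pop 1) (Seq (pour 1 0) (push_word 0 w))"

lemma runs_restore_input:
  "runs g (restore_input w) s (8 * length (s 1) + length w + 3)
    (s(1 := [], 0 := w @ rev (tl (s 1)) @ s 0))"
proof -
  have "runs g (restore_input w) s (1 + (8 * length (tl (s 1)) + 1 + (length w + 1)))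
      (s(1 := [], 0 := w @ rev (tl (s 1)) @ s 0))"
    using runs_Seq[OF runs_Pop[of g 1 s] runs_Seq[OF runs_pour[of 1 0] runs_push_word[of g 0 w]]]
    by (simp add: restore_input_def)
  then show ?thesis by (rule runs_mono) simp
qed

definition append_scenario_prog :: "word \<Rightarrow> bool \<Rightarrow> prog" where
  "append_scenario_prog w unit =
     Seq reverse_input (Seq (Push 0 Close) (Seq (push_scenario unit) (restore_input w)))"

lemma query_free_append_scenario_prog: "query_free (append_scenario_prog w u)"
  by (simp add: append_scenario_prog_def reverse_input_def push_scenario_def restore_input_def
      move_prefix_def push_job_def push_per_symbol_def pour_def query_free_push_word
      query_free_move_top)

lemma outputs_append_scenario_prog:
  "outputs g (append_scenario_prog w u) [x]
     (poly [:length w + 9, length (added_job_word 0) + 22, 17:] (length x))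
     (append_scenario_word w u x)"
proof -
  define n where "n = length (leading_ones x)"
  let ?t = "rev (leading_ones x)"
  let ?z = "enc_list added_job_word (replicate n (time_exponent u x)) @ [Close]"
  let ?s = "(\<lambda>_. [])(1 := rev x, 3 := [], 0 := ?z) :: state"
  have "runs g reverse_input (init [x]) (9 * length x + 2) ((\<lambda>_. [])(1 := rev x, 3 := ?t))"
    by (rule runs_reverse_input)
  moreover have "runs g (Push 0 Close) ((\<lambda>_. [])(1 := rev x, 3 := ?t)) 1
      ((\<lambda>_. [])(1 := rev x, 3 := ?t, 0 := [Close]))"
    using runs_Push[of g 0 Close "(\<lambda>_. [])(1 := rev x, 3 := ?t)"] by simp
  moreover have "runs g (push_scenario u) ((\<lambda>_. [])(1 := rev x, 3 := ?t, 0 := [Close]))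
      (n * (length (added_job_word 0) + 17 * length x + 5) + 3) ?s"
    using runs_push_scenario[of "(\<lambda>_. [])(1 := rev x, 3 := ?t, 0 := [Close])" g u]
    by (simp add: n_def time_exponent_rev)
  moreover have "runs g (restore_input w) ?s
      (8 * length x + length w + 3) (?s(1 := [], 0 := append_scenario_word w u x))"
    using runs_restore_input[of g w ?s] butlast_rev[of "rev x"]
    by (simp add: append_scenario_word_def n_def)
  ultimately have "runs g (append_scenario_prog w u) (init [x])
      (9 * length x + 2 + (1 + (n * (length (added_job_word 0) + 17 * length x + 5) + 3 +
        (8 * length x + length w + 3))))
      (?s(1 := [], 0 := append_scenario_word w u x))"
    unfolding append_scenario_prog_def by (intro runs_Seq)
  then have run: "runs g (append_scenario_prog w u) (init [x])
      (poly [:length w + 9, length (added_job_word 0) + 22, 17:] (length x))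
      (?s(1 := [], 0 := append_scenario_word w u x))"
  proof (rule runs_mono)
    have "n * (length (added_job_word 0) + 17 * length x + 5)
        \<le> length x * (length (added_job_word 0) + 17 * length x + 5)"
      by (intro mult_right_mono) (simp_all add: n_def leading_ones_def length_takeWhile_le)
    then show "9 * length x + 2 + (1 + (n * (length (added_job_word 0) + 17 * length x + 5) + 3 +
        (8 * length x + length w + 3)))
        \<le> poly [:length w + 9, length (added_job_word 0) + 22, 17:] (length x)"
      by (simp add: algebra_simps)
  qed
  show ?thesis
    unfolding outputs_iff_runs by (rule exI, rule conjI, rule run) simp
qed

lemma polytime_computable_append_scenario_word:
  "polytime_computable (append_scenario_word w u)"
  unfolding polytime_computable_def
  using query_free_append_scenario_prog outputs_append_scenario_prog by blast

section \<open>Scheduling costs\<close>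

lemma completion_mono:
  assumes "\<And>i. i \<in> set \<pi> \<Longrightarrow> p i \<le> p' i" "j \<in> set \<pi>"
  shows "completion p \<pi> j \<le> completion p' \<pi> j"
  unfolding completion_def using assms
  by (intro add_mono sum_list_mono) (auto dest: set_takeWhileD)

lemma cost_mono:
  assumes w: "\<And>i. i \<in> set \<pi> \<Longrightarrow> 0 \<le> w i" and p: "\<And>i. i \<in> set \<pi> \<Longrightarrow> p i \<le> p' i"
    and d: "\<And>i. i \<in> set \<pi> \<Longrightarrow> d' i \<le> d i" and "\<pi> \<noteq> []"
  shows "cost \<gamma> w p d \<pi> \<le> cost \<gamma> w p' d' \<pi>"
proof -
  have completion: "completion p \<pi> j \<le> completion p' \<pi> j" if "j \<in> set \<pi>" for j
    using completion_mono p that by blast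
  have tardiness: "w j * tardiness p d \<pi> j \<le> w j * tardiness p' d' \<pi> j" if "j \<in> set \<pi>" for j
    using completion[OF that] d[OF that] w[OF that]
    by (auto simp: tardiness_def intro!: mult_left_mono)
  show ?thesis
  proof (cases \<gamma>)
    case FlowTime
    then show ?thesis using completion w by (auto intro!: sum_mono mult_left_mono)
  next
    case Tardiness
    then show ?thesis using tardiness by (auto intro!: sum_mono)
  next
    case MaxTardiness
    have "w j * tardiness p d \<pi> j \<le> Max ((\<lambda>j. w j * tardiness p' d' \<pi> j) ` set \<pi>)"
      if "j \<in> set \<pi>" for j
      using tardiness[OF that] that by (meson List.finite_set Max_ge finite_imageI imageI order_trans)
    then show ?thesis using MaxTardiness \<open>\<pi> \<noteq> []\<close> by (auto intro!: Max.boundedI)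
  next
    case LateJobs
    have "late p d \<pi> j \<le> late p' d' \<pi> j" if "j \<in> set \<pi>" for j
      using completion[OF that] d[OF that] by (simp add: late_def)
    then show ?thesis using LateJobs w by (auto intro!: sum_mono mult_left_mono)
  qed
qed

lemma completion_constant:
  assumes "\<And>i. i \<in> set \<pi> \<Longrightarrow> p i = c" "distinct \<pi>" "i < length \<pi>"
  shows "completion p \<pi> (\<pi> ! i) = c * (real i + 1)"
proof -
  have "takeWhile (\<lambda>k. k \<noteq> \<pi> ! i) \<pi> = take i \<pi>"
    using assms(2,3) by (intro takeWhile_eq_take_P_nth) (auto simp: nth_eq_iff_index_eq)
  moreover have "map p (take i \<pi>) = replicate i c"
    using assms by (intro replicate_eqI) (auto dest: in_set_takeD)
  ultimately show ?thesis
    using assms by (simp add: completion_def sum_list_replicate algebra_simps)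
qed

text \<open>With equal processing times and due dates the schedules only permute the completion times.\<close>

lemma cost_identical_jobs:
  assumes p: "\<And>i. i \<in> set \<pi> \<Longrightarrow> p i = c" and d: "\<And>i. i \<in> set \<pi> \<Longrightarrow> d i = e" and "distinct \<pi>"
  shows "cost \<gamma> (\<lambda>_. w) p d \<pi> = cost \<gamma> (\<lambda>_. w) (\<lambda>_. c) (\<lambda>_. e) [0..<length \<pi>]"
proof -
  let ?n = "length \<pi>"
  have bij: "bij_betw ((!) \<pi>) {..<?n} (set \<pi>)"
    using bij_betw_nth[OF \<open>distinct \<pi>\<close>] by auto
  have completion: "completion p \<pi> (\<pi> ! i) = completion (\<lambda>_. c) [0..<?n] i" if "i < ?n" for i
    using completion_constant[of \<pi> p c i] completion_constant[of "[0..<?n]" "\<lambda>_. c" c i]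
      p \<open>distinct \<pi>\<close> that by auto
  have due: "d (\<pi> ! i) = e" if "i < ?n" for i
    using d that by simp
  have "(\<Sum>j\<in>set \<pi>. h j) = (\<Sum>i<?n. h (\<pi> ! i))" for h :: "nat \<Rightarrow> real"
    by (rule sum.reindex_bij_betw[OF bij, symmetric])
  moreover have "h ` set \<pi> = (\<lambda>i. h (\<pi> ! i)) ` {..<?n}" for h :: "nat \<Rightarrow> real"
    using bij by (metis bij_betw_imp_surj_on image_image)
  ultimately show ?thesis
    using completion due
    by (cases \<gamma>) (simp_all add: tardiness_def late_def atLeast0LessThan cong: image_cong_simp)
qed

section \<open>Risk measures\<close>

lemma VaR_eqI:
  assumes "measure_pmf.prob Y {..<v} < \<alpha>" "\<alpha> \<le> measure_pmf.prob Y {..v}"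
  shows "VaR \<alpha> Y = v"
proof -
  have "\<alpha> \<le> measure_pmf.prob Y {..t} \<longleftrightarrow> v \<le> t" for t
  proof (cases "v \<le> t")
    case True
    then have "measure_pmf.prob Y {..v} \<le> measure_pmf.prob Y {..t}"
      by (intro measure_pmf.finite_measure_mono) auto
    with True assms(2) show ?thesis by simp
  next
    case False
    then have "measure_pmf.prob Y {..t} \<le> measure_pmf.prob Y {..<v}"
      by (intro measure_pmf.finite_measure_mono) auto
    with False assms(1) show ?thesis by simp
  qed
  then have "{t. measure_pmf.prob Y {..t} \<ge> \<alpha>} = {v..}" by auto
  then show ?thesis by (simp add: VaR_def)
qed

definition expected_excess :: "real pmf \<Rightarrow> real \<Rightarrow> real" where
  "expected_excess Y \<gamma> = measure_pmf.expectation Y (\<lambda>y. max 0 (y - \<gamma>))"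

lemma expected_excess_add_prob_le:
  assumes int: "integrable (measure_pmf Y) (\<lambda>y. y)"
    and le: "\<And>y. max 0 (y - v) + c * indicator A y \<le> max 0 (y - \<gamma>)"
  shows "expected_excess Y v + c * measure_pmf.prob Y A \<le> expected_excess Y \<gamma>"
proof -
  have excess: "integrable (measure_pmf Y) (\<lambda>y. max 0 (y - t))" for t :: real
    using int by simp
  have ind: "integrable (measure_pmf Y) (\<lambda>y. c * indicator A y)"
    by (intro integrable_mult_right integrable_real_indicator)
      (simp_all add: measure_pmf.emeasure_eq_measure)
  have "measure_pmf.expectation Y (\<lambda>y. max 0 (y - v) + c * indicator A y)
      \<le> measure_pmf.expectation Y (\<lambda>y. max 0 (y - \<gamma>))"
    using excess ind le by (intro integral_mono) auto
  then show ?thesis using excess ind by (simp add: expected_excess_def)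
qed

lemma expected_excess_ge_at_quantile:
  assumes int: "integrable (measure_pmf Y) (\<lambda>y. y)"
    and v: "measure_pmf.prob Y {..<v} \<le> \<alpha>" "\<alpha> \<le> measure_pmf.prob Y {..v}"
  shows "expected_excess Y v + (v - \<gamma>) * (1 - \<alpha>) \<le> expected_excess Y \<gamma>"
proof (cases "\<gamma> \<le> v")
  case True
  have "1 - \<alpha> \<le> measure_pmf.prob Y {v..}"
    using v(1) measure_pmf.prob_compl[of "{..<v}" Y] by (simp flip: Compl_eq_Diff_UNIV)
  then have "(v - \<gamma>) * (1 - \<alpha>) \<le> (v - \<gamma>) * measure_pmf.prob Y {v..}"
    using True by (intro mult_left_mono) auto
  moreover have "max 0 (y - v) + (v - \<gamma>) * indicator {v..} y \<le> max 0 (y - \<gamma>)" for y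
    using True by (simp add: indicator_def)
  note expected_excess_add_prob_le[OF int this]
  ultimately show ?thesis by simp
next
  case False
  have "measure_pmf.prob Y {v<..} \<le> 1 - \<alpha>"
    using v(2) measure_pmf.prob_compl[of "{..v}" Y] by (simp flip: Compl_eq_Diff_UNIV)
  then have "(v - \<gamma>) * (1 - \<alpha>) \<le> (v - \<gamma>) * measure_pmf.prob Y {v<..}"
    using False by (intro mult_left_mono_neg) auto
  moreover have "max 0 (y - v) + (v - \<gamma>) * indicator {v<..} y \<le> max 0 (y - \<gamma>)" for y
    using False by (simp add: indicator_def)
  note expected_excess_add_prob_le[OF int this]
  ultimately show ?thesis by simp
qed

lemma CVaR_eq_at_quantile:
  assumes "\<alpha> < 1" and int: "integrable (measure_pmf Y) (\<lambda>y. y)"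
    and v: "measure_pmf.prob Y {..<v} \<le> \<alpha>" "\<alpha> \<le> measure_pmf.prob Y {..v}"
  shows "CVaR \<alpha> Y = v + 1 / (1 - \<alpha>) * expected_excess Y v"
proof -
  have "v + 1 / (1 - \<alpha>) * expected_excess Y v \<le> \<gamma> + 1 / (1 - \<alpha>) * expected_excess Y \<gamma>" for \<gamma>
  proof -
    have "(expected_excess Y v + (v - \<gamma>) * (1 - \<alpha>)) / (1 - \<alpha>) \<le> expected_excess Y \<gamma> / (1 - \<alpha>)"
      using \<open>\<alpha> < 1\<close> by (intro divide_right_mono expected_excess_ge_at_quantile[OF int v]) simp
    then show ?thesis
      using \<open>\<alpha> < 1\<close> by (simp add: add_divide_distrib)
  qed
  then show ?thesis
    unfolding CVaR_def expected_excess_def by (intro cInf_eq_minimum) auto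
qed

text \<open>The probability \<open>1 - a\<close> is less than the tail mass \<open>1 - \<alpha>\<close>, but together with \<open>a / K\<close> it
  exceeds the tail mass.\<close>

locale tail_split =
  fixes K :: nat and \<alpha> a :: real
  assumes K_pos: "K > 0"
    and level: "0 < \<alpha>" "\<alpha> < a" "a < 1" "a - a / K < \<alpha>"

locale dominated_outcomes = tail_split +
  fixes fs :: "real list" and M :: real
  assumes length_fs: "length fs = K"
    and le_M: "\<And>f. f \<in> set fs \<Longrightarrow> f \<le> M"
begin

definition outcomes :: "(real \<times> real) list" where
  "outcomes = zip (fs @ [M]) (replicate K (a / K) @ [1 - a])"

abbreviation "Y \<equiv> pmf_of_list outcomes"
abbreviation "worst \<equiv> Max (set fs)"

lemma worst: "worst \<in> set fs" "f \<in> set fs \<Longrightarrow> f \<le> worst" "worst \<le> M"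
  using length_fs K_pos le_M by auto

lemma outcomes_eq: "outcomes = map (\<lambda>f. (f, a / K)) fs @ [(M, 1 - a)]"
  using length_fs by (simp add: outcomes_def zip_replicate2)

lemma outcomes_wf: "pmf_of_list_wf outcomes"
  unfolding pmf_of_list_wf_def outcomes_eq using level K_pos length_fs
  by (auto simp: comp_def map_replicate_const sum_list_replicate)

lemma prob_outcomes:
  "measure_pmf.prob Y A = length (filter (\<lambda>f. f \<in> A) fs) * (a / K) + (if M \<in> A then 1 - a else 0)"
  by (subst measure_pmf_of_list[OF outcomes_wf])
     (simp add: outcomes_eq filter_map comp_def map_replicate_const sum_list_replicate)

lemma prob_less_worst: "measure_pmf.prob Y {..<worst} < \<alpha>"
proof -
  have "length (filter (\<lambda>f. f < worst) fs) < K"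
    using length_filter_less[OF worst(1), of "\<lambda>f. f < worst"] length_fs by simp
  then have "length (filter (\<lambda>f. f < worst) fs) * (a / K) \<le> (real K - 1) * (a / K)"
    using level by (intro mult_right_mono) auto
  also have "\<dots> < \<alpha>"
    using level K_pos by (simp add: field_simps)
  finally show ?thesis
    using worst(3) by (simp add: prob_outcomes)
qed

lemma prob_le_worst: "\<alpha> \<le> measure_pmf.prob Y {..worst}"
proof -
  have "filter (\<lambda>f. f \<le> worst) fs = fs"
    using worst(2) by (simp add: filter_id_conv)
  then show ?thesis
    using level K_pos length_fs by (simp add: prob_outcomes)
qed

lemma VaR_outcomes: "VaR \<alpha> Y = worst"
  using prob_less_worst prob_le_worst by (rule VaR_eqI)

lemma expected_excess_worst: "expected_excess Y worst = (1 - a) * (M - worst)"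
proof -
  have "max 0 (y - worst) = (M - worst) * indicator {worst<..} y" if "y \<in> set_pmf Y" for y
  proof -
    have "y \<in> set fs \<or> y = M"
      using set_pmf_of_list[OF outcomes_wf] that by (auto simp: outcomes_eq)
    then have "y \<le> worst \<or> y = M"
      using worst(2) by blast
    then show ?thesis
      by (cases "y \<le> worst") simp_all
  qed
  then have "expected_excess Y worst =
      measure_pmf.expectation Y (\<lambda>y. (M - worst) * indicator {worst<..} y)"
    unfolding expected_excess_def by (intro integral_cong_AE) (auto simp: AE_measure_pmf_iff)
  also have "\<dots> = (M - worst) * measure_pmf.prob Y {worst<..}"
    by simp
  also have "filter (\<lambda>f. f > worst) fs = []"
    using worst(2) by (simp add: filter_empty_conv not_less)
  then have "(M - worst) * measure_pmf.prob Y {worst<..} = (1 - a) * (M - worst)"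
    using worst(3) by (simp add: prob_outcomes)
  finally show ?thesis .
qed

lemma CVaR_outcomes: "CVaR \<alpha> Y = ((1 - a) * M + (a - \<alpha>) * worst) / (1 - \<alpha>)"
proof -
  have "integrable (measure_pmf Y) (\<lambda>y. y)"
    by (rule integrable_measure_pmf_finite[OF finite_set_pmf_of_list[OF outcomes_wf]])
  then have "CVaR \<alpha> Y = worst + 1 / (1 - \<alpha>) * ((1 - a) * (M - worst))"
    using CVaR_eq_at_quantile[of \<alpha> Y worst] prob_less_worst prob_le_worst level
    by (simp add: expected_excess_worst)
  then show ?thesis
    using level by (simp add: field_simps)
qed

end

lemma exists_tail_split:
  fixes K :: nat and \<alpha> :: real
  assumes "K \<ge> 2" "0 < \<alpha>" "\<alpha> < 1"
  shows "\<exists>a :: rat. tail_split K \<alpha> (of_rat a)"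
proof -
  have "\<alpha> < \<alpha> * K / (real K - 1)"
    using assms by (simp add: field_simps)
  then obtain a where a: "\<alpha> < of_rat a" "of_rat a < min 1 (\<alpha> * K / (real K - 1))"
    using assms of_rat_dense[of \<alpha> "min 1 (\<alpha> * K / (real K - 1))"] by auto
  then have "of_rat a - of_rat a / K < \<alpha>"
    using assms by (simp add: field_simps)
  with a assms have "tail_split K \<alpha> (of_rat a)"
    by unfold_locales auto
  then show ?thesis ..
qed

section \<open>The reduction\<close>

definition added_time :: "problem \<Rightarrow> uncertain_instance \<Rightarrow> rat" where
  "added_time P I = 2 ^ time_exponent (unit_times P) (enc_uncertain I)"

definition added_scenario :: "problem \<Rightarrow> uncertain_instance \<Rightarrow> scenario" where
  "added_scenario P I = replicate (njobs I) (added_time P I, 0)"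

definition added_cost :: "problem \<Rightarrow> uncertain_instance \<Rightarrow> real" where
  "added_cost P I =
     cost (criterion_of P) (\<lambda>_. 1) (\<lambda>_. of_rat (added_time P I)) (\<lambda>_. 0) [0..<njobs I]"

definition risk_instance :: "problem \<Rightarrow> rat \<Rightarrow> uncertain_instance \<Rightarrow> stochastic_instance" where
  "risk_instance P a I =
     (I\<lparr>scenarios := scenarios I @ [added_scenario P I]\<rparr>,
      replicate (length (scenarios I)) (a / of_nat (length (scenarios I))) @ [1 - a])"

definition risk_word :: "problem \<Rightarrow> nat \<Rightarrow> rat \<Rightarrow> word \<Rightarrow> word" where
  "risk_word P K a = append_scenario_word
     (enc_list enc_rat (replicate K (a / of_nat K) @ [1 - a])) (unit_times P)"

lemma enc_risk_instance:
  assumes "length (scenarios I) = K"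
  shows "enc_stochastic (risk_instance P a I) = risk_word P K a (enc_uncertain I)"
proof -
  have "leading_ones (enc_uncertain I) = replicate (njobs I) (Digit True)"
    by (simp add: leading_ones_def enc_uncertain_eq takeWhile_append)
  then show ?thesis
    by (simp add: assms risk_word_def append_scenario_word_def)
      (simp add: assms risk_instance_def enc_stochastic_def added_scenario_def added_time_def
        added_job_word_def enc_uncertain_eq enc_list_def butlast_append)
qed

lemma length_le_length_enc_list:
  assumes "x \<in> set xs"
  shows "length (e x) \<le> length (enc_list e xs)"
proof -
  have "length (e x) \<le> sum_list (map (length \<circ> e) xs)"
    using assms by (intro member_le_sum_list) auto
  then show ?thesis
    by (simp add: enc_list_def length_concat)
qed

lemma le_two_power_length_enc_rat: "r \<le> 2 ^ length (enc_rat r)"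
proof -
  define n where "n = nat (fst (quotient_of r))"
  have denom: "snd (quotient_of r) > 0" by (rule quotient_of_denom_pos')
  have "r = of_int (fst (quotient_of r)) / of_int (snd (quotient_of r))"
    by (rule quotient_of_div) simp
  also have "\<dots> \<le> of_nat n / of_int (snd (quotient_of r))"
    using denom by (intro divide_right_mono) (auto simp: n_def)
  also have "\<dots> \<le> of_nat n / 1"
    using denom by (intro divide_left_mono) auto
  also have "\<dots> \<le> of_nat (2 ^ length (enc_rat r))"
  proof -
    have "n < 2 ^ length (bits n)" by (rule less_two_power_length_bits)
    also have "\<dots> \<le> 2 ^ length (enc_rat r)"
      by (intro power_increasing) (auto simp: enc_rat_def enc_nat_def n_def)
    finally show ?thesis by (simp only: div_by_1 of_nat_le_iff less_imp_le)
  qed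
  finally show ?thesis by simp
qed

lemma processing_time_le_added_time:
  assumes "I \<in> uncertain_instances P K" "\<xi> \<in> set (scenarios I)" "(p, d) \<in> set \<xi>"
  shows "p \<le> added_time P I"
proof (cases "unit_times P")
  case True
  then show ?thesis
    using assms
    by (auto simp: uncertain_instances_def valid_scenario_def added_time_def time_exponent_def)
next
  case False
  have "length (enc_rat p) \<le> length (enc_job (p, d))"
    by (simp add: enc_job_def)
  also have "\<dots> \<le> length (enc_list enc_job \<xi>)"
    by (rule length_le_length_enc_list) fact
  also have "\<dots> \<le> length (enc_list (enc_list enc_job) (scenarios I))"
    by (rule length_le_length_enc_list) fact
  also have "\<dots> \<le> length (enc_uncertain I)"
    by (simp add: enc_uncertain_eq)
  finally have "(2 :: rat) ^ length (enc_rat p) \<le> added_time P I"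
    using False by (auto simp: added_time_def time_exponent_def intro: power_increasing)
  with le_two_power_length_enc_rat[of p] show ?thesis by (rule order_trans)
qed

lemma risk_instance_in_stochastic_instances:
  assumes "I \<in> uncertain_instances P K" "0 < a" "a < 1" "K > 0"
  shows "risk_instance P a I \<in> stochastic_instances P (K + 1)"
proof -
  have "valid_scenario P (njobs I) (added_scenario P I)"
    by (auto simp: valid_scenario_def added_scenario_def added_time_def time_exponent_def)
  then show ?thesis
    using assms
    by (auto simp: risk_instance_def stochastic_instances_def uncertain_instances_def
        sum_list_replicate)
qed

lemma schedules_risk_instance: "schedules (fst (risk_instance P a I)) = schedules I"
  by (simp add: schedules_def risk_instance_def)

lemma finite_solutions_Min_Max: "finite (solutions (Min_Max P K) I)"
  by (simp add: Min_Max_def schedules_def)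

lemma schedulesD:
  assumes "\<pi> \<in> schedules I"
  shows "set \<pi> = {..<njobs I}" "distinct \<pi>" "length \<pi> = njobs I"
  using assms by (auto simp: schedules_def permutations_of_set_def dest: distinct_card)

lemma unit_weight_cost_added_scenario:
  assumes "\<pi> \<in> schedules I"
  shows "unit_weight_cost P \<pi> (added_scenario P I) = added_cost P I"
  unfolding unit_weight_cost_def added_cost_def schedulesD(3)[OF assms, symmetric]
  by (rule cost_identical_jobs)
    (use schedulesD[OF assms] in \<open>auto simp: ptime_def ddate_def added_scenario_def\<close>)

lemma unit_weight_cost_le_added_cost:
  assumes I: "I \<in> uncertain_instances P K" and \<xi>: "\<xi> \<in> set (scenarios I)" and \<pi>: "\<pi> \<in> schedules I"
  shows "unit_weight_cost P \<pi> \<xi> \<le> added_cost P I"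
proof -
  have valid: "valid_scenario P (njobs I) \<xi>" and n: "njobs I > 0"
    using I \<xi> by (simp_all add: uncertain_instances_def)
  have "unit_weight_cost P \<pi> \<xi> \<le> unit_weight_cost P \<pi> (added_scenario P I)"
    unfolding unit_weight_cost_def
  proof (rule cost_mono)
    fix i assume "i \<in> set \<pi>"
    then have i: "i < njobs I" by (simp add: schedulesD[OF \<pi>])
    then have mem: "(fst (\<xi> ! i), snd (\<xi> ! i)) \<in> set \<xi>"
      using valid by (simp add: valid_scenario_def)
    show "ptime \<xi> i \<le> ptime (added_scenario P I) i"
      using processing_time_le_added_time[OF I \<xi> mem] i
      by (simp add: ptime_def added_scenario_def of_rat_less_eq)
    have "0 \<le> snd (\<xi> ! i)"
      using valid mem unfolding valid_scenario_def by blast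
    then show "ddate (added_scenario P I) i \<le> ddate \<xi> i"
      using i by (simp add: ddate_def added_scenario_def)
  qed (use schedulesD(3)[OF \<pi>] n in auto)
  then show ?thesis by (simp add: unit_weight_cost_added_scenario[OF \<pi>])
qed

locale risk_reduction = tail_split K \<alpha> "of_rat a" for K \<alpha> and a :: rat +
  fixes P :: problem
begin

lemma probability_bounds: "0 < a" "a < 1"
proof -
  have "(0 :: real) < of_rat a" using level by linarith
  then show "0 < a" by simp
  show "a < 1" using level(3) by simp
qed

lemma instance_reduction_Min_Risk:
  "instance_reduction (Min_Max P K) (Min_Risk \<phi> P (K + 1)) (risk_word P K a) (risk_instance P a)"
proof
  show "polytime_computable (risk_word P K a)"
    unfolding risk_word_def by (rule polytime_computable_append_scenario_word)
  show "inj_on (enc_instance (Min_Risk \<phi> P (K + 1))) (instances (Min_Risk \<phi> P (K + 1)))"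
    by (simp add: Min_Risk_def inj_on_enc_stochastic)
  fix I assume "I \<in> instances (Min_Max P K)"
  then have I: "I \<in> uncertain_instances P K"
    by (simp add: Min_Max_def)
  then show "risk_instance P a I \<in> instances (Min_Risk \<phi> P (K + 1))"
    using risk_instance_in_stochastic_instances probability_bounds K_pos by (simp add: Min_Risk_def)
  show "enc_instance (Min_Risk \<phi> P (K + 1)) (risk_instance P a I) =
      risk_word P K a (enc_instance (Min_Max P K) I)"
    using I by (simp add: Min_Max_def Min_Risk_def enc_risk_instance uncertain_instances_def)
qed (simp_all add: Min_Max_def Min_Risk_def schedules_risk_instance)

lemma objective_risk_instance:
  assumes I: "I \<in> instances (Min_Max P K)" and \<pi>: "\<pi> \<in> solutions (Min_Max P K) I"
  shows "objective (Min_VaR \<alpha> P (K + 1)) (risk_instance P a I) \<pi> = objective (Min_Max P K) I \<pi>"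
    and "objective (Min_CVaR \<alpha> P (K + 1)) (risk_instance P a I) \<pi> =
      ((1 - of_rat a) * added_cost P I + (of_rat a - \<alpha>) * objective (Min_Max P K) I \<pi>) / (1 - \<alpha>)"
proof -
  define fs where "fs = map (unit_weight_cost P \<pi>) (scenarios I)"
  have I': "I \<in> uncertain_instances P K" and \<pi>': "\<pi> \<in> schedules I"
    using I \<pi> by (simp_all add: Min_Max_def)
  then have len: "length (scenarios I) = K"
    by (simp add: uncertain_instances_def)
  interpret dominated_outcomes K \<alpha> "of_rat a" fs "added_cost P I"
    using unit_weight_cost_le_added_cost[OF I' _ \<pi>'] len by unfold_locales (auto simp: fs_def)
  have "random_cost P (risk_instance P a I) \<pi> = Y"
    unfolding outcomes_def random_cost_def using len unit_weight_cost_added_scenario[OF \<pi>', of P]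
    by (simp add: risk_instance_def fs_def of_rat_divide of_rat_diff)
  moreover have "objective (Min_Max P K) I \<pi> = worst"
    by (simp add: Min_Max_def fs_def)
  ultimately show
    "objective (Min_VaR \<alpha> P (K + 1)) (risk_instance P a I) \<pi> = objective (Min_Max P K) I \<pi>"
    "objective (Min_CVaR \<alpha> P (K + 1)) (risk_instance P a I) \<pi> =
      ((1 - of_rat a) * added_cost P I + (of_rat a - \<alpha>) * objective (Min_Max P K) I \<pi>) / (1 - \<alpha>)"
    by (simp_all add: Min_VaR_def Min_CVaR_def Min_Risk_def VaR_outcomes CVaR_outcomes)
qed

sublocale VaR: instance_reduction
  "Min_Max P K" "Min_VaR \<alpha> P (K + 1)" "risk_word P K a" "risk_instance P a"
  unfolding Min_VaR_def by (rule instance_reduction_Min_Risk)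

sublocale CVaR: instance_reduction
  "Min_Max P K" "Min_CVaR \<alpha> P (K + 1)" "risk_word P K a" "risk_instance P a"
  unfolding Min_CVaR_def by (rule instance_reduction_Min_Risk)

lemma NP_hard_Min_VaR: "NP_hard (Min_Max P K) \<Longrightarrow> NP_hard (Min_VaR \<alpha> P (K + 1))"
  by (rule VaR.NP_hard_if_order_preserving)
    (simp_all only: finite_solutions_Min_Max objective_risk_instance)

lemma hard_to_approximate_Min_VaR:
  "hard_to_approximate \<rho> (Min_Max P K) \<Longrightarrow> hard_to_approximate \<rho> (Min_VaR \<alpha> P (K + 1))"
  by (rule VaR.hard_to_approximate_if_objective_preserving) (simp_all only: objective_risk_instance)

lemma NP_hard_Min_CVaR: "NP_hard (Min_Max P K) \<Longrightarrow> NP_hard (Min_CVaR \<alpha> P (K + 1))"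
proof (rule CVaR.NP_hard_if_order_preserving)
  fix I \<pi> \<pi>'
  assume "I \<in> instances (Min_Max P K)"
    and "\<pi> \<in> solutions (Min_Max P K) I" "\<pi>' \<in> solutions (Min_Max P K) I"
  note objective = objective_risk_instance(2)[OF this(1,2)] objective_risk_instance(2)[OF this(1,3)]
  have "\<alpha> < 1" using level by linarith
  then show "objective (Min_CVaR \<alpha> P (K + 1)) (risk_instance P a I) \<pi>
      \<le> objective (Min_CVaR \<alpha> P (K + 1)) (risk_instance P a I) \<pi>' \<longleftrightarrow>
      objective (Min_Max P K) I \<pi> \<le> objective (Min_Max P K) I \<pi>'"
    unfolding objective using level(2) by (simp add: divide_le_cancel)
qed (simp_all add: finite_solutions_Min_Max)

end

theorem theorem2:
  fixes P :: problem and K :: nat and \<rho> :: real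
  assumes "K \<ge> 2" and "\<rho> > 1"
    and "NP_hard (Min_Max P K)"
    and "hard_to_approximate \<rho> (Min_Max P K)"
  shows "(\<forall>\<alpha>. 0 < \<alpha> \<and> \<alpha> < 1 \<longrightarrow>
            NP_hard (Min_VaR \<alpha> P (K + 1)) \<and> hard_to_approximate \<rho> (Min_VaR \<alpha> P (K + 1))) \<and>
         (\<forall>\<alpha>. 0 < \<alpha> \<and> \<alpha> < 1 \<longrightarrow> NP_hard (Min_CVaR \<alpha> P (K + 1)))"
proof -
  have "NP_hard (Min_VaR \<alpha> P (K + 1)) \<and> hard_to_approximate \<rho> (Min_VaR \<alpha> P (K + 1)) \<and>
      NP_hard (Min_CVaR \<alpha> P (K + 1))" if \<alpha>: "0 < \<alpha>" "\<alpha> < 1" for \<alpha> :: real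
  proof -
    obtain a :: rat where "tail_split K \<alpha> (of_rat a)"
      using exists_tail_split[OF assms(1) \<alpha>] by blast
    then interpret risk_reduction K \<alpha> a P
      by (simp add: risk_reduction_def)
    show ?thesis
      using assms(3,4) NP_hard_Min_VaR hard_to_approximate_Min_VaR NP_hard_Min_CVaR by blast
  qed
  then show ?thesis by blast
qed

end
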